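(* The variety of $2$-dimensional Leibniz--Poisson algebras over $\mathbb C$ has exactly four irreducible components: the closures $\overline{O(L_3)}$, $\overline{O(L_4)}$, $\overline{\bigcup_{\alpha\in\mathbb C}O(L_5^{\alpha})}$ and $\overline{\bigcup_{\alpha\in\mathbb C}O(L_6^{\alpha})}$.
   Context: A Leibniz--Poisson algebra is a complex vector space with a commutative associative product $\cdot$ and a bilinear bracket $[-,-]$ satisfying $[[x,y],z]=[[x,z],y]+[x,[y,z]]$ and $[x\cdot y,z]=[x,z]\cdot y+x\cdot[y,z]$. Fix a $2$-dimensional complex vector space $V$ with basis $e_1,e_2$. The variety of $2$-dimensional Leibniz--Poisson algebras is the Zariski closed set of pairs $(\mu,\mu')\in \mathrm{Bil}(V\times V,V)^2\cong\mathbb C^{16}$ such that $\mu$ (as $\cdot$) and $\mu'$ (as $[-,-]$) define a Leibniz--Poisson algebra. $\mathrm{GL}(V)$ acts on it by $(g*(\mu,\mu'))(x,y)=(g\mu(g^{-1}x,g^{-1}y),\,g\mu'(g^{-1}x,g^{-1}y))$; $O(T)$ denotes the orbit of (a structure representing) the algebra $T$, and closures are Zariski closures. The algebras are (unlisted products are zero, $\cdot$ is commutative): $L_3: [e_1,e_2]=e_2,\ [e_2,e_1]=-e_2$ (with $\cdot=0$); $L_4: e_1\cdot e_1=e_1,\ e_2\cdot e_2=e_2$; $L_5^{\alpha}: e_1\cdot e_1=e_1,\ e_1\cdot e_2=e_2,\ [e_2,e_1]=\alpha e_2$; $L_6^{\alpha}: e_1\cdot e_1=e_1,\ [e_2,e_1]=\alpha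 e_2$. *)

theory Defs
  imports "HOL-Analysis.Analysis"
begin

definition bilinear_map :: "('k::field \<Rightarrow> 'v::ab_group_add \<Rightarrow> 'v) \<Rightarrow> ('v \<Rightarrow> 'v \<Rightarrow> 'v) \<Rightarrow> bool" where
  "bilinear_map scl f \<longleftrightarrow>
     (\<forall>x. Vector_Spaces.linear scl scl (\<lambda>y. f x y)) \<and>
     (\<forall>y. Vector_Spaces.linear scl scl (\<lambda>x. f x y))"

locale leibniz_poisson_algebra = vector_space scl
  for scl :: "complex \<Rightarrow> 'v::ab_group_add \<Rightarrow> 'v" +
  fixes prd :: "'v \<Rightarrow> 'v \<Rightarrow> 'v"
    and brk :: "'v \<Rightarrow> 'v \<Rightarrow> 'v"
  assumes prd_bilinear: "bilinear_map scl prd"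
    and prd_commute: "prd x y = prd y x"
    and prd_assoc: "prd (prd x y) z = prd x (prd y z)"
    and brk_bilinear: "bilinear_map scl brk"
    and leibniz: "brk (brk x y) z = brk (brk x z) y + brk x (brk y z)"
    and poisson: "brk (prd x y) z = prd (brk x z) y + prd x (brk y z)"

type_synonym vec2 = "complex^2"
type_synonym bil = "vec2 \<Rightarrow> vec2 \<Rightarrow> vec2"

abbreviation e\<^sub>1 :: vec2 where "e\<^sub>1 \<equiv> axis 1 1"
abbreviation e\<^sub>2 :: vec2 where "e\<^sub>2 \<equiv> axis 2 1"

definition Bil :: "bil set" where
  "Bil = {\<mu>. bilinear_map (*s) \<mu>}"

definition LP_variety :: "(bil \<times> bil) set" where
  "LP_variety = {(\<mu>, \<mu>') \<in> Bil \<times> Bil. leibniz_poisson_algebra (*s) \<mu> \<mu>'}"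

text \<open>Zariski topology on \<open>Bil \<times> Bil\<close>, which is identified with affine 16-space by means of the
  structure constants with respect to the standard basis. As the complex field is infinite,
  polynomials in 16 variables are the same as polynomial functions.\<close>

inductive polynomial_fun :: "(bil \<times> bil \<Rightarrow> complex) \<Rightarrow> bool" where
  const: "polynomial_fun (\<lambda>_. c)"
| coord_prd: "polynomial_fun (\<lambda>(\<mu>, \<mu>'). \<mu> (axis i 1) (axis j 1) $ k)"
| coord_brk: "polynomial_fun (\<lambda>(\<mu>, \<mu>'). \<mu>' (axis i 1) (axis j 1) $ k)"
| add: "polynomial_fun p \<Longrightarrow> polynomial_fun q \<Longrightarrow> polynomial_fun (\<lambda>T. p T + q T)"
| mult: "polynomial_fun p \<Longrightarrow> polynomial_fun q \<Longrightarrow> polynomial_fun (\<lambda>T. p T * q T)"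

definition zariski_closed :: "(bil \<times> bil) set \<Rightarrow> bool" where
  "zariski_closed S \<longleftrightarrow>
     (\<exists>P. (\<forall>p\<in>P. polynomial_fun p) \<and> S = {T \<in> Bil \<times> Bil. \<forall>p\<in>P. p T = 0})"

definition zariski :: "(bil \<times> bil) topology" where
  "zariski = topology (\<lambda>U. U \<subseteq> Bil \<times> Bil \<and> zariski_closed (Bil \<times> Bil - U))"

lemma zariski_closed_empty: "zariski_closed {}"
  unfolding zariski_closed_def
  by (rule exI[of _ "{\<lambda>_. 1}"]) (auto intro: polynomial_fun.const)

lemma zariski_closed_Un:
  assumes "zariski_closed A" "zariski_closed B"
  shows "zariski_closed (A \<union> B)"
proof -
  obtain P Q where P: "\<forall>p\<in>P. polynomial_fun p" "A = {T \<in> Bil \<times> Bil. \<forall>p\<in>P. p T = 0}"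
    and Q: "\<forall>q\<in>Q. polynomial_fun q" "B = {T \<in> Bil \<times> Bil. \<forall>q\<in>Q. q T = 0}"
    using assms unfolding zariski_closed_def by blast
  let ?R = "(\<lambda>(p, q) T. p T * q T) ` (P \<times> Q)"
  have "\<forall>r\<in>?R. polynomial_fun r"
    using P(1) Q(1) by (auto intro: polynomial_fun.mult)
  moreover have "A \<union> B = {T \<in> Bil \<times> Bil. \<forall>r\<in>?R. r T = 0}"
  proof -
    have "(\<forall>r\<in>?R. r T = 0) \<longleftrightarrow> (\<forall>p\<in>P. p T = 0) \<or> (\<forall>q\<in>Q. q T = 0)" for T
      by (simp only: ball_simps split_paired_Ball_Sigma prod.case mult_eq_0_iff)
    then show ?thesis
      unfolding P(2) Q(2) by blast
  qed
  ultimately show ?thesis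
    unfolding zariski_closed_def by blast
qed

lemma zariski_closed_Inter:
  assumes "\<And>S. S \<in> \<S> \<Longrightarrow> zariski_closed S"
  shows "zariski_closed (Bil \<times> Bil \<inter> \<Inter>\<S>)"
proof -
  have "\<forall>S\<in>\<S>. \<exists>P. (\<forall>p\<in>P. polynomial_fun p) \<and> S = {T \<in> Bil \<times> Bil. \<forall>p\<in>P. p T = 0}"
    using assms unfolding zariski_closed_def by blast
  from bchoice[OF this] obtain P where
    "\<forall>S\<in>\<S>. (\<forall>p\<in>P S. polynomial_fun p) \<and> S = {T \<in> Bil \<times> Bil. \<forall>p\<in>P S. p T = 0}" ..
  note P = bspec[OF this, THEN conjunct1] bspec[OF this, THEN conjunct2]
  have "Bil \<times> Bil \<inter> \<Inter>\<S> = {T \<in> Bil \<times> Bil. \<forall>p\<in>\<Union>(P ` \<S>). p T = 0}"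
  proof (rule set_eqI)
    fix T
    have "T \<in> S \<longleftrightarrow> T \<in> Bil \<times> Bil \<and> (\<forall>p\<in>P S. p T = 0)" if "S \<in> \<S>" for S
      by (subst P(2)[OF that]) simp
    then show "T \<in> Bil \<times> Bil \<inter> \<Inter>\<S> \<longleftrightarrow>
        T \<in> {T \<in> Bil \<times> Bil. \<forall>p\<in>\<Union>(P ` \<S>). p T = 0}"
      by (simp del: mem_Times_iff) blast
  qed
  moreover have "\<forall>p\<in>\<Union>(P ` \<S>). polynomial_fun p"
    using P(1) by blast
  ultimately show ?thesis
    unfolding zariski_closed_def by blast
qed

lemma istopology_zariski:
  "istopology (\<lambda>U. U \<subseteq> Bil \<times> Bil \<and> zariski_closed (Bil \<times> Bil - U))"
  unfolding istopology_def
proof (intro conjI allI impI)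
  fix S U :: "(bil \<times> bil) set"
  assume "S \<subseteq> Bil \<times> Bil \<and> zariski_closed (Bil \<times> Bil - S)"
    and "U \<subseteq> Bil \<times> Bil \<and> zariski_closed (Bil \<times> Bil - U)"
  then show "S \<inter> U \<subseteq> Bil \<times> Bil" and "zariski_closed (Bil \<times> Bil - S \<inter> U)"
    unfolding Diff_Int by (blast intro: zariski_closed_Un)+
next
  fix \<K> :: "(bil \<times> bil) set set"
  assume K: "\<forall>K\<in>\<K>. K \<subseteq> Bil \<times> Bil \<and> zariski_closed (Bil \<times> Bil - K)"
  then show "\<Union>\<K> \<subseteq> Bil \<times> Bil"
    by blast
  have "A - \<Union>\<K> = A \<inter> \<Inter>((\<lambda>K. A - K) ` \<K>)" for A
    by blast
  moreover have "zariski_closed (Bil \<times> Bil \<inter> \<Inter>((\<lambda>K. Bil \<times> Bil - K) ` \<K>))"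
    using K by (intro zariski_closed_Inter) blast
  ultimately show "zariski_closed (Bil \<times> Bil - \<Union>\<K>)"
    by simp
qed

lemma openin_zariski:
  "openin zariski U \<longleftrightarrow> U \<subseteq> Bil \<times> Bil \<and> zariski_closed (Bil \<times> Bil - U)"
  unfolding zariski_def topology_inverse'[OF istopology_zariski] ..

lemma topspace_zariski: "topspace zariski = Bil \<times> Bil"
proof -
  have "openin zariski (Bil \<times> Bil)"
    by (simp add: openin_zariski zariski_closed_empty)
  moreover have "topspace zariski \<subseteq> Bil \<times> Bil"
    using openin_zariski openin_topspace by blast
  ultimately show ?thesis
    using openin_subset by blast
qed

lemma closedin_zariski: "closedin zariski S \<longleftrightarrow> zariski_closed S"
proof -
  have "zariski_closed S \<Longrightarrow> S \<subseteq> Bil \<times> Bil"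
    unfolding zariski_closed_def by blast
  then show ?thesis
    by (auto simp: closedin_def topspace_zariski openin_zariski double_diff)
qed

definition irreducible_in :: "'a topology \<Rightarrow> 'a set \<Rightarrow> bool" where
  "irreducible_in X S \<longleftrightarrow>
     S \<subseteq> topspace X \<and> S \<noteq> {} \<and>
     (\<forall>A B. closedin X A \<and> closedin X B \<and> S \<subseteq> A \<union> B \<longrightarrow> S \<subseteq> A \<or> S \<subseteq> B)"

definition irreducible_components :: "'a topology \<Rightarrow> 'a set set" where
  "irreducible_components X =
     {S. irreducible_in X S \<and> (\<forall>T. irreducible_in X T \<and> S \<subseteq> T \<longrightarrow> T = S)}"

definition GL_V :: "(vec2 \<Rightarrow> vec2) set" where
  "GL_V = {g. Vector_Spaces.linear (*s) (*s) g \<and> bij g}"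

definition act :: "(vec2 \<Rightarrow> vec2) \<Rightarrow> bil \<times> bil \<Rightarrow> bil \<times> bil" where
  "act g = (\<lambda>(\<mu>, \<mu>').
     (\<lambda>x y. g (\<mu> (inv g x) (inv g y)), \<lambda>x y. g (\<mu>' (inv g x) (inv g y))))"

definition orbit :: "bil \<times> bil \<Rightarrow> (bil \<times> bil) set" where
  "orbit T = {act g T | g. g \<in> GL_V}"

text \<open>The bilinear map with \<open>e\<^sub>1e\<^sub>1 = a\<close>, \<open>e\<^sub>1e\<^sub>2 = b\<close>, \<open>e\<^sub>2e\<^sub>1 = c\<close> and \<open>e\<^sub>2e\<^sub>2 = d\<close>.\<close>

definition bil_table :: "vec2 \<Rightarrow> vec2 \<Rightarrow> vec2 \<Rightarrow> vec2 \<Rightarrow> bil" where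
  "bil_table a b c d = (\<lambda>x y.
     (x $ 1 * y $ 1) *s a + (x $ 1 * y $ 2) *s b + (x $ 2 * y $ 1) *s c + (x $ 2 * y $ 2) *s d)"

definition L\<^sub>3 :: "bil \<times> bil" where
  "L\<^sub>3 = (bil_table 0 0 0 0, bil_table 0 e\<^sub>2 (- e\<^sub>2) 0)"

definition L\<^sub>4 :: "bil \<times> bil" where
  "L\<^sub>4 = (bil_table e\<^sub>1 0 0 e\<^sub>2, bil_table 0 0 0 0)"

definition L\<^sub>5 :: "complex \<Rightarrow> bil \<times> bil" where
  "L\<^sub>5 \<alpha> = (bil_table e\<^sub>1 e\<^sub>2 e\<^sub>2 0, bil_table 0 0 (\<alpha> *s e\<^sub>2) 0)"

definition L\<^sub>6 :: "complex \<Rightarrow> bil \<times> bil" where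
  "L\<^sub>6 \<alpha> = (bil_table e\<^sub>1 0 0 0, bil_table 0 0 (\<alpha> *s e\<^sub>2) 0)"

end

(* Every orbit family is the image of GL(V) x C, hence rationally connected by curves over lines of
   matrices, hence irreducible. For the covering, if some v is independent of v^2, then the
   product is that of the ideal (x) in C[x]/(x (x - r) (x - s)); without such a v the product is
   zero and the bracket is an arbitrary Leibniz bracket. In each normal form the derivation property
   of right multiplications leaves at most one bracket parameter; all structures not isomorphic to
   some L_3, L_4, L_5, L_6 are limits of the family L_6. Non-inclusions follow from closed
   conditions invariant under GL(V) that hold on one family and fail on the other. *)

theory Submission
  imports Defs "HOL-Computational_Algebra.Polynomial"
begin

subsection \<open>Irreducible components of topological spaces\<close>

text \<open>Components are recognised by a purely topological criterion: finitely many closed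
  irreducible sets cover the space and none lies in another. All closures are formed in the affine
  space of pairs of bilinear maps; the subspace \<open>LP_variety\<close> enters only at the end.
  Besides the derivation property, the classification lives on one consequence of the Leibniz
  identity, [x, [y, y]] = 0, which removes the bracket parameters left over. Degenerations are
  ordinary limits t -> 0 of structure constants, since polynomials are continuous; the base changes
  that realise them blow up at t = 0, so limits are taken of the structures and not of the matrices.
  Five closed conditions suffice for all twelve non-inclusions.\<close>

lemma irreducible_in_subset_Union:
  assumes "irreducible_in X S" "finite F" "\<And>C. C \<in> F \<Longrightarrow> closedin X C" "S \<subseteq> \<Union>F"
  shows "\<exists>C\<in>F. S \<subseteq> C"
  using assms(2-4)
proof (induction F)
  case empty
  then show ?case using assms(1) by (auto simp: irreducible_in_def)
next
  case (insert C F)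
  have "closedin X C" "closedin X (\<Union>F)"
    using insert by (auto intro: closedin_Union)
  then have "S \<subseteq> C \<or> S \<subseteq> \<Union>F"
    using assms(1) insert.prems unfolding irreducible_in_def by (metis Union_insert)
  then show ?case using insert by auto
qed

text \<open>Since the cover is finite and closed, every irreducible set lies in a single member of
  \<open>F\<close>. So a maximal irreducible set is a member, and a member can be enlarged only
  inside another member, which \<open>incomparable\<close> excludes.\<close>

lemma irreducible_components_eq:
  assumes fin: "finite F" and cover: "topspace X = \<Union>F"
    and closed: "\<And>C. C \<in> F \<Longrightarrow> closedin X C"
    and irred: "\<And>C. C \<in> F \<Longrightarrow> irreducible_in X C"
    and incomparable: "\<And>C D. C \<in> F \<Longrightarrow> D \<in> F \<Longrightarrow> C \<subseteq> D \<Longrightarrow> C = D"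
  shows "irreducible_components X = F"
proof -
  have sub: "\<exists>C\<in>F. S \<subseteq> C" if "irreducible_in X S" for S
    using irreducible_in_subset_Union[OF that fin closed] that cover
    by (auto simp: irreducible_in_def)
  show ?thesis
  proof (intro set_eqI iffI)
    fix S assume "S \<in> irreducible_components X"
    then show "S \<in> F"
      using sub[of S] irred unfolding irreducible_components_def by blast
  next
    fix C assume C: "C \<in> F"
    have "T = C" if T: "irreducible_in X T" "C \<subseteq> T" for T
    proof -
      obtain D where "D \<in> F" "T \<subseteq> D" using sub[OF T(1)] by blast
      with T(2) C incomparable[of C D] show ?thesis by blast
    qed
    with irred[OF C] show "C \<in> irreducible_components X"
      unfolding irreducible_components_def by blast
  qed
qed

lemma irreducible_in_closure_of:
  assumes "irreducible_in X S"
  shows "irreducible_in X (X closure_of S)"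
proof -
  have S: "S \<subseteq> X closure_of S"
    using assms by (simp add: irreducible_in_def closure_of_subset)
  show ?thesis
    unfolding irreducible_in_def
  proof (intro conjI allI impI)
    show "X closure_of S \<subseteq> topspace X" by (rule closure_of_subset_topspace)
    show "X closure_of S \<noteq> {}" using S assms by (auto simp: irreducible_in_def)
    fix A B assume AB: "closedin X A \<and> closedin X B \<and> X closure_of S \<subseteq> A \<union> B"
    with S have "S \<subseteq> A \<or> S \<subseteq> B"
      using assms unfolding irreducible_in_def by (meson order_trans)
    with AB show "X closure_of S \<subseteq> A \<or> X closure_of S \<subseteq> B"
      by (meson closure_of_minimal)
  qed
qed

text \<open>Bridges the ambient space, where irreducibility is proved, and the subspace whose
  components are sought: closed sets of the subspace are traces of closed sets.\<close>

lemma irreducible_in_subtopology: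
  assumes "irreducible_in X S" "S \<subseteq> Y"
  shows "irreducible_in (subtopology X Y) S"
  unfolding irreducible_in_def
proof (intro conjI allI impI)
  show "S \<subseteq> topspace (subtopology X Y)" "S \<noteq> {}"
    using assms by (auto simp: irreducible_in_def)
  fix A B
  assume AB: "closedin (subtopology X Y) A \<and> closedin (subtopology X Y) B \<and> S \<subseteq> A \<union> B"
  then obtain A' B' where "closedin X A'" "A = A' \<inter> Y" "closedin X B'" "B = B' \<inter> Y"
    by (auto simp: closedin_subtopology)
  moreover from this AB have "S \<subseteq> A' \<union> B'" by blast
  ultimately show "S \<subseteq> A \<or> S \<subseteq> B"
    using assms unfolding irreducible_in_def by (metis le_inf_iff)
qed

subsection \<open>Coordinates\<close>

text \<open>The determinant of the matrix with columns \<open>u\<close> and \<open>w\<close>; its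
  being nonzero is how a basis is expressed below.\<close>

definition wedge :: "vec2 \<Rightarrow> vec2 \<Rightarrow> complex" where
  "wedge u w = u $ 1 * w $ 2 - u $ 2 * w $ 1"

definition frame :: "vec2 \<Rightarrow> vec2 \<Rightarrow> vec2 \<Rightarrow> vec2" where
  "frame u w x = x $ 1 *s u + x $ 2 *s w"

text \<open>Cramer's rule for the inverse of \<open>frame u w\<close>. The explicit division by the
  determinant later makes the action visibly rational along a line of matrices.\<close>

definition coframe :: "vec2 \<Rightarrow> vec2 \<Rightarrow> vec2 \<Rightarrow> vec2" where
  "coframe u w x = (wedge x w / wedge u w) *s e\<^sub>1 + (wedge u x / wedge u w) *s e\<^sub>2"

lemma axis_components [simp]:
  "e\<^sub>1 $ 1 = 1" "e\<^sub>1 $ 2 = 0" "e\<^sub>2 $ 1 = 0" "e\<^sub>2 $ 2 = 1"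
  by (simp_all add: axis_def)

lemma frame_axis [simp]: "frame u w e\<^sub>1 = u" "frame u w e\<^sub>2 = w"
  by (simp_all add: frame_def)

lemma frame_coframe:
  assumes "wedge u w \<noteq> 0" shows "frame u w (coframe u w x) = x"
proof -
  have "wedge x w * u $ k + wedge u x * w $ k = wedge u w * x $ k" for k
    using exhaust_2[of k] by (auto simp: wedge_def algebra_simps)
  then show ?thesis using assms
    by (simp add: vec_eq_iff frame_def coframe_def field_simps)
qed

lemma coframe_frame:
  assumes "wedge u w \<noteq> 0" shows "coframe u w (frame u w x) = x"
proof -
  have "wedge (frame u w x) w = x $ 1 * wedge u w" "wedge u (frame u w x) = x $ 2 * wedge u w"
    by (simp_all add: wedge_def frame_def algebra_simps)
  then show ?thesis using assms
    by (simp add: vec_eq_iff forall_2 coframe_def)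
qed

lemma linear_frame: "Vector_Spaces.linear (*s) (*s) (frame u w)"
  unfolding Vector_Spaces.linear_iff
  by (simp add: frame_def vec.vector_space_axioms vec_eq_iff algebra_simps)

lemma vec2_expand: "(x::vec2) = x $ 1 *s e\<^sub>1 + x $ 2 *s e\<^sub>2"
  by (simp add: vec_eq_iff forall_2)

lemma linear_eq_frame:
  assumes "Vector_Spaces.linear (*s) (*s) g"
  shows "g = frame (g e\<^sub>1) (g e\<^sub>2)"
proof
  fix x :: vec2
  have "g (x $ 1 *s e\<^sub>1 + x $ 2 *s e\<^sub>2) = x $ 1 *s g e\<^sub>1 + x $ 2 *s g e\<^sub>2"
    using assms unfolding Vector_Spaces.linear_iff by simp
  then show "g x = frame (g e\<^sub>1) (g e\<^sub>2) x"
    by (simp flip: vec2_expand add: frame_def)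
qed

lemma inv_frame: "wedge u w \<noteq> 0 \<Longrightarrow> inv (frame u w) = coframe u w"
  by (rule inv_equality) (simp_all add: frame_coframe coframe_frame)

lemma frame_in_GL_V: "wedge u w \<noteq> 0 \<Longrightarrow> frame u w \<in> GL_V"
  unfolding GL_V_def
  by (auto simp: linear_frame frame_coframe coframe_frame intro!: o_bij[of "coframe u w"])

lemma GL_V_frame:
  assumes "g \<in> GL_V"
  obtains u w where "wedge u w \<noteq> 0" "g = frame u w"
proof -
  define u w where "u = g e\<^sub>1" and "w = g e\<^sub>2"
  have g: "g = frame u w" and inj: "inj g"
    using assms linear_eq_frame unfolding GL_V_def u_def w_def by (auto simp: bij_def)
  have "wedge u w \<noteq> 0"
  proof
    assume 0: "wedge u w = 0"
    \<comment> \<open>For dependent columns the vector with coordinates \<open>- (w $ k)\<close> and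
      \<open>u $ k\<close> is in the kernel for both k. Injectivity gives u = 0, so the first basis
      vector is in the kernel as well.\<close>
    have u: "u $ 1 *s w - w $ 1 *s u = 0" "u $ 2 *s w - w $ 2 *s u = 0"
      using 0 by (auto simp: vec_eq_iff forall_2 wedge_def algebra_simps)
    have "g (- (w $ k) *s e\<^sub>1 + u $ k *s e\<^sub>2) = g 0" for k
      using u exhaust_2[of k] unfolding g frame_def by (auto simp: algebra_simps)
    then have "- (w $ k) *s e\<^sub>1 + u $ k *s e\<^sub>2 = 0" for k
      using inj by (meson injD)
    then have "u = 0" by (auto simp: vec_eq_iff forall_2)
    then have "g e\<^sub>1 = g 0" by (simp add: g) (simp add: frame_def)
    with inj have "e\<^sub>1 = 0" by (meson injD)
    then show False by (simp add: vec_eq_iff forall_2)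
  qed
  with g show ?thesis using that by blast
qed

lemma GL_V_comp: "g \<in> GL_V \<Longrightarrow> h \<in> GL_V \<Longrightarrow> g \<circ> h \<in> GL_V"
  unfolding GL_V_def by (auto intro: Vector_Spaces.linear_compose bij_comp)

lemma GL_V_inv: "g \<in> GL_V \<Longrightarrow> inv g \<in> GL_V"
proof -
  assume "g \<in> GL_V"
  then obtain u w where g: "wedge u w \<noteq> 0" "g = frame u w" by (rule GL_V_frame)
  have "coframe u w = frame (coframe u w e\<^sub>1) (coframe u w e\<^sub>2)"
    by (intro linear_eq_frame)
       (simp add: Vector_Spaces.linear_iff vec.vector_space_axioms coframe_def wedge_def
          vec_eq_iff field_simps add_divide_distrib diff_divide_distrib)
  then have "Vector_Spaces.linear (*s) (*s) (inv g)"
    using g by (metis inv_frame linear_frame)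
  with \<open>g \<in> GL_V\<close> show ?thesis by (simp add: GL_V_def bij_imp_bij_inv)
qed

lemma GL_V_add: "g \<in> GL_V \<Longrightarrow> g (x + y) = g x + g y"
  and GL_V_inv_apply: "g \<in> GL_V \<Longrightarrow> inv g (g x) = x"
  and GL_V_apply_inv: "g \<in> GL_V \<Longrightarrow> g (inv g x) = x"
  by (simp_all add: GL_V_def Vector_Spaces.linear_iff bij_is_inj bij_is_surj surj_f_inv_f)

section \<open>The action of GL(V) on pairs of bilinear maps\<close>

lemma act_act:
  assumes "g \<in> GL_V" "h \<in> GL_V" shows "act g (act h T) = act (g \<circ> h) T"
proof -
  have "inv (g \<circ> h) = inv h \<circ> inv g"
    using assms by (intro o_inv_distrib) (auto simp: GL_V_def)
  then show ?thesis by (simp add: act_def split: prod.split)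
qed

lemma act_inv:
  assumes "g \<in> GL_V" shows "act g (act (inv g) T) = T" "act (inv g) (act g T) = T"
proof -
  have "inv (inv g) = g" using assms by (simp add: GL_V_def inv_inv_eq)
  then show "act g (act (inv g) T) = T" "act (inv g) (act g T) = T" using assms
    by (simp_all add: act_def GL_V_inv_apply GL_V_apply_inv split: prod.split)
qed

lemma act_id: "act id T = T"
  by (simp add: act_def split: prod.split)

lemma id_in_GL_V: "id \<in> GL_V"
  by (simp add: GL_V_def vec.linear_id)

lemma act_in_orbit: "g \<in> GL_V \<Longrightarrow> T \<in> orbit S \<Longrightarrow> act g T \<in> orbit S"
  unfolding orbit_def by (auto simp: act_act intro: GL_V_comp)

lemma self_in_orbit: "T \<in> orbit T"
  unfolding orbit_def using act_id id_in_GL_V by (metis (mono_tags, lifting) mem_Collect_eq)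

section \<open>Structure constants of bilinear maps\<close>

lemma bil_table_in_Bil: "bil_table a b c d \<in> Bil"
  unfolding Bil_def bilinear_map_def Vector_Spaces.linear_iff
  by (simp add: bil_table_def vec.vector_space_axioms vec_eq_iff algebra_simps)

lemma Bil_eq_table:
  assumes "\<mu> \<in> Bil"
  shows "\<mu> = bil_table (\<mu> e\<^sub>1 e\<^sub>1) (\<mu> e\<^sub>1 e\<^sub>2) (\<mu> e\<^sub>2 e\<^sub>1) (\<mu> e\<^sub>2 e\<^sub>2)"
proof (intro ext)
  fix x y
  have 1: "\<mu> x = frame (\<mu> x e\<^sub>1) (\<mu> x e\<^sub>2)" for x
    using assms by (intro linear_eq_frame) (auto simp: Bil_def bilinear_map_def)
  have 2: "(\<lambda>x. \<mu> x y) = frame (\<mu> e\<^sub>1 y) (\<mu> e\<^sub>2 y)" for y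
    using assms by (intro linear_eq_frame) (auto simp: Bil_def bilinear_map_def)
  have "\<mu> x y = y $ 1 *s \<mu> x e\<^sub>1 + y $ 2 *s \<mu> x e\<^sub>2"
    by (subst 1) (simp add: frame_def)
  moreover have "\<mu> x z = x $ 1 *s \<mu> e\<^sub>1 z + x $ 2 *s \<mu> e\<^sub>2 z" for z
    using fun_cong[OF 2, of x z] by (simp add: frame_def)
  ultimately show "\<mu> x y = bil_table (\<mu> e\<^sub>1 e\<^sub>1) (\<mu> e\<^sub>1 e\<^sub>2) (\<mu> e\<^sub>2 e\<^sub>1) (\<mu> e\<^sub>2 e\<^sub>2) x y"
    by (simp add: bil_table_def vec_eq_iff algebra_simps)
qed

lemma bil_table_eq_iff:
  "bil_table a b c d = bil_table a' b' c' d' \<longleftrightarrow> a = a' \<and> b = b' \<and> c = c' \<and> d = d'"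
proof
  assume "bil_table a b c d = bil_table a' b' c' d'"
  then have "bil_table a b c d x y = bil_table a' b' c' d' x y" for x y by simp
  from this[of e\<^sub>1 e\<^sub>1] this[of e\<^sub>1 e\<^sub>2] this[of e\<^sub>2 e\<^sub>1] this[of e\<^sub>2 e\<^sub>2]
  show "a = a' \<and> b = b' \<and> c = c' \<and> d = d'" by (simp add: bil_table_def)
qed simp

lemma bil_table_axis [simp]:
  "bil_table a b c d e\<^sub>1 e\<^sub>1 = a" "bil_table a b c d e\<^sub>1 e\<^sub>2 = b"
  "bil_table a b c d e\<^sub>2 e\<^sub>1 = c" "bil_table a b c d e\<^sub>2 e\<^sub>2 = d"
  by (simp_all add: bil_table_def)

lemma Bil_cases:
  assumes "\<mu> \<in> Bil" obtains a b c d where "\<mu> = bil_table a b c d"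
  using Bil_eq_table[OF assms] by blast

lemma Bil_add:
  assumes "\<mu> \<in> Bil"
  shows "\<mu> (x + y) z = \<mu> x z + \<mu> y z" "\<mu> z (x + y) = \<mu> z x + \<mu> z y"
    "\<mu> (r *s x) z = r *s \<mu> x z" "\<mu> z (r *s x) = r *s \<mu> z x"
    "\<mu> (x - y) z = \<mu> x z - \<mu> y z" "\<mu> z (x - y) = \<mu> z x - \<mu> z y"
    "\<mu> (- x) z = - \<mu> x z" "\<mu> z (- x) = - \<mu> z x"
  using assms by (auto elim!: Bil_cases simp: bil_table_def vec_eq_iff algebra_simps)

lemma act_in_Bil:
  assumes "g \<in> GL_V" "T \<in> Bil \<times> Bil" shows "act g T \<in> Bil \<times> Bil"
proof -
  have "(\<lambda>x y. g (\<mu> (inv g x) (inv g y))) \<in> Bil" if "\<mu> \<in> Bil" for \<mu>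
    using that assms(1) GL_V_inv[OF assms(1)]
    unfolding Bil_def bilinear_map_def Vector_Spaces.linear_iff GL_V_def by simp
  with assms(2) show ?thesis by (auto simp: act_def)
qed

section \<open>Leibniz-Poisson structures and change of basis\<close>

lemma LP_variety_iff:
  "(\<mu>, \<nu>) \<in> LP_variety \<longleftrightarrow> \<mu> \<in> Bil \<and> \<nu> \<in> Bil \<and>
    (\<forall>x y. \<mu> x y = \<mu> y x) \<and> (\<forall>x y z. \<mu> (\<mu> x y) z = \<mu> x (\<mu> y z)) \<and>
    (\<forall>x y z. \<nu> (\<nu> x y) z = \<nu> (\<nu> x z) y + \<nu> x (\<nu> y z)) \<and>
    (\<forall>x y z. \<nu> (\<mu> x y) z = \<mu> (\<nu> x z) y + \<mu> x (\<nu> y z))"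
  unfolding LP_variety_def leibniz_poisson_algebra_def leibniz_poisson_algebra_axioms_def Bil_def
  by (auto simp: vec.vector_space_axioms)

lemma act_in_LP_variety:
  assumes g: "g \<in> GL_V" and T: "T \<in> LP_variety" shows "act g T \<in> LP_variety"
proof -
  obtain \<mu> \<nu> where T': "T = (\<mu>, \<nu>)" by (cases T)
  have "act g T \<in> Bil \<times> Bil" using act_in_Bil[OF g] T by (auto simp: T' LP_variety_iff)
  moreover have ids: "\<mu> x y = \<mu> y x" "\<mu> (\<mu> x y) z = \<mu> x (\<mu> y z)"
    "\<nu> (\<nu> x y) z = \<nu> (\<nu> x z) y + \<nu> x (\<nu> y z)"
    "\<nu> (\<mu> x y) z = \<mu> (\<nu> x z) y + \<mu> x (\<nu> y z)" for x y z
    using T unfolding T' LP_variety_iff by blast+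
  ultimately show ?thesis
    unfolding T' act_def prod.case LP_variety_iff GL_V_inv_apply[OF g] GL_V_add[OF g, symmetric]
    by (intro conjI allI arg_cong[where f = g] ids) auto
qed

text \<open>Turns a multiplication table in a basis \<open>u\<close>, \<open>w\<close> into a
  statement about the action, so that exhibiting a suitable basis proves membership in an
  orbit.\<close>

lemma pair_in_basis:
  assumes "wedge u w \<noteq> 0" and "\<mu> \<in> Bil" "\<nu> \<in> Bil"
    and "\<mu> u u = frame u w a" "\<mu> u w = frame u w b" "\<mu> w u = frame u w c" "\<mu> w w = frame u w d"
    and "\<nu> u u = frame u w a'" "\<nu> u w = frame u w b'" "\<nu> w u = frame u w c'" "\<nu> w w = frame u w d'"
  shows "(\<mu>, \<nu>) = act (frame u w) (bil_table a b c d, bil_table a' b' c' d')"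
proof -
  have *: "\<mu> = (\<lambda>x y. frame u w (bil_table a b c d (coframe u w x) (coframe u w y)))"
    if "\<mu> \<in> Bil" "\<mu> u u = frame u w a" "\<mu> u w = frame u w b" "\<mu> w u = frame u w c" "\<mu> w w = frame u w d"
    for \<mu> a b c d
  proof (intro ext)
    fix x y
    have "\<mu> (frame u w p) (frame u w q) = frame u w (bil_table a b c d p q)" for p q
      using that(2-5)
      by (simp add: frame_def[of _ _ p] frame_def[of _ _ q] Bil_add[OF that(1)])
         (simp add: frame_def bil_table_def vec_eq_iff algebra_simps)
    from this[of "coframe u w x" "coframe u w y"]
    show "\<mu> x y = frame u w (bil_table a b c d (coframe u w x) (coframe u w y))"
      by (simp add: frame_coframe assms(1))
  qed
  show ?thesis
    using *[OF assms(2,4-7)] *[OF assms(3,8-11)]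
    by (simp add: act_def inv_frame assms(1))
qed

subsection \<open>Polynomial functions and closed sets\<close>

text \<open>Agreement with a polynomial is asked only on bilinear pairs, because only there is
  \<open>fst T x y\<close> for general \<open>x\<close> and \<open>y\<close> determined by structure
  constants.\<close>

definition regular :: "(bil \<times> bil \<Rightarrow> complex) \<Rightarrow> bool" where
  "regular f \<longleftrightarrow> (\<exists>p. polynomial_fun p \<and> (\<forall>T\<in>Bil \<times> Bil. f T = p T))"

lemma regular_const [intro]: "regular (\<lambda>_. c)"
  unfolding regular_def by (blast intro: polynomial_fun.const)

lemma regular_add [intro]:
  assumes "regular f" "regular g" shows "regular (\<lambda>T. f T + g T)"
proof -
  obtain p q where "polynomial_fun p" "\<forall>T\<in>Bil \<times> Bil. f T = p T"
    "polynomial_fun q" "\<forall>T\<in>Bil \<times> Bil. g T = q T"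
    using assms unfolding regular_def by blast
  then show ?thesis unfolding regular_def
    by (intro exI[of _ "\<lambda>T. p T + q T"]) (simp add: polynomial_fun.add)
qed

lemma regular_mult [intro]:
  assumes "regular f" "regular g" shows "regular (\<lambda>T. f T * g T)"
proof -
  obtain p q where "polynomial_fun p" "\<forall>T\<in>Bil \<times> Bil. f T = p T"
    "polynomial_fun q" "\<forall>T\<in>Bil \<times> Bil. g T = q T"
    using assms unfolding regular_def by blast
  then show ?thesis unfolding regular_def
    by (intro exI[of _ "\<lambda>T. p T * q T"]) (simp add: polynomial_fun.mult)
qed

lemma regular_diff [intro]:
  assumes "regular f" "regular g" shows "regular (\<lambda>T. f T - g T)"
  using regular_add[OF assms(1) regular_mult[OF regular_const[of "-1"] assms(2)]] by simp

lemma regular_coord: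
  "regular (\<lambda>T. fst T (axis i 1) (axis j 1) $ k)" "regular (\<lambda>T. snd T (axis i 1) (axis j 1) $ k)"
  unfolding regular_def using polynomial_fun.coord_prd polynomial_fun.coord_brk
  by (force simp: case_prod_unfold)+

lemma Bil_apply:
  assumes "\<mu> \<in> Bil"
  shows "\<mu> x y $ k = x $ 1 * y $ 1 * \<mu> e\<^sub>1 e\<^sub>1 $ k + x $ 1 * y $ 2 * \<mu> e\<^sub>1 e\<^sub>2 $ k
    + x $ 2 * y $ 1 * \<mu> e\<^sub>2 e\<^sub>1 $ k + x $ 2 * y $ 2 * \<mu> e\<^sub>2 e\<^sub>2 $ k"
  by (subst Bil_eq_table[OF assms]) (simp add: bil_table_def)

lemma regular_cong:
  assumes "regular f" "\<And>T. T \<in> Bil \<times> Bil \<Longrightarrow> g T = f T" shows "regular g"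
  using assms unfolding regular_def by metis

text \<open>Expand by bilinearity. The arguments may depend on \<open>T\<close>, so nested products
  as in the associative law are covered.\<close>

lemma regular_fst [intro]:
  assumes "\<And>k. regular (\<lambda>T. U T $ k)" "\<And>k. regular (\<lambda>T. V T $ k)"
  shows "regular (\<lambda>T. fst T (U T) (V T) $ k)"
proof (rule regular_cong)
  show "fst T (U T) (V T) $ k = U T $ 1 * V T $ 1 * fst T e\<^sub>1 e\<^sub>1 $ k
      + U T $ 1 * V T $ 2 * fst T e\<^sub>1 e\<^sub>2 $ k + U T $ 2 * V T $ 1 * fst T e\<^sub>2 e\<^sub>1 $ k
      + U T $ 2 * V T $ 2 * fst T e\<^sub>2 e\<^sub>2 $ k" if "T \<in> Bil \<times> Bil" for T
    using that by (intro Bil_apply) auto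
  show "regular (\<lambda>T. U T $ 1 * V T $ 1 * fst T e\<^sub>1 e\<^sub>1 $ k
      + U T $ 1 * V T $ 2 * fst T e\<^sub>1 e\<^sub>2 $ k + U T $ 2 * V T $ 1 * fst T e\<^sub>2 e\<^sub>1 $ k
      + U T $ 2 * V T $ 2 * fst T e\<^sub>2 e\<^sub>2 $ k)"
    by (intro regular_add regular_mult assms regular_coord)
qed

lemma regular_snd [intro]:
  assumes "\<And>k. regular (\<lambda>T. U T $ k)" "\<And>k. regular (\<lambda>T. V T $ k)"
  shows "regular (\<lambda>T. snd T (U T) (V T) $ k)"
proof (rule regular_cong)
  show "snd T (U T) (V T) $ k = U T $ 1 * V T $ 1 * snd T e\<^sub>1 e\<^sub>1 $ k
      + U T $ 1 * V T $ 2 * snd T e\<^sub>1 e\<^sub>2 $ k + U T $ 2 * V T $ 1 * snd T e\<^sub>2 e\<^sub>1 $ k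
      + U T $ 2 * V T $ 2 * snd T e\<^sub>2 e\<^sub>2 $ k" if "T \<in> Bil \<times> Bil" for T
    using that by (intro Bil_apply) auto
  show "regular (\<lambda>T. U T $ 1 * V T $ 1 * snd T e\<^sub>1 e\<^sub>1 $ k
      + U T $ 1 * V T $ 2 * snd T e\<^sub>1 e\<^sub>2 $ k + U T $ 2 * V T $ 1 * snd T e\<^sub>2 e\<^sub>1 $ k
      + U T $ 2 * V T $ 2 * snd T e\<^sub>2 e\<^sub>2 $ k)"
    by (intro regular_add regular_mult assms regular_coord)
qed

lemma regular_wedge [intro]:
  assumes "\<And>k. regular (\<lambda>T. U T $ k)" "\<And>k. regular (\<lambda>T. V T $ k)"
  shows "regular (\<lambda>T. wedge (U T) (V T))"
  unfolding wedge_def by (intro regular_diff regular_mult assms)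

lemma closedin_zariski_zeros:
  assumes "\<And>i. regular (f i)"
  shows "closedin zariski {T \<in> Bil \<times> Bil. \<forall>i. f i T = 0}"
proof -
  have "\<forall>i. \<exists>p. polynomial_fun p \<and> (\<forall>T\<in>Bil \<times> Bil. f i T = p T)"
    using assms unfolding regular_def by blast
  then obtain p where "\<forall>i. polynomial_fun (p i) \<and> (\<forall>T\<in>Bil \<times> Bil. f i T = p i T)"
    by metis
  then show ?thesis
    unfolding closedin_zariski zariski_closed_def by (intro exI[of _ "range p"]) auto
qed

lemma closedin_zariski_identity:
  fixes f :: "vec2 \<Rightarrow> vec2 \<Rightarrow> vec2 \<Rightarrow> bil \<times> bil \<Rightarrow> vec2"
  assumes "\<And>x y z k. regular (\<lambda>T. f x y z T $ k)"
  shows "closedin zariski {T \<in> Bil \<times> Bil. \<forall>x y z. f x y z T = 0}"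
proof -
  have "closedin zariski {T \<in> Bil \<times> Bil. \<forall>i::vec2 \<times> vec2 \<times> vec2 \<times> 2.
      f (fst i) (fst (snd i)) (fst (snd (snd i))) T $ snd (snd (snd i)) = 0}"
    by (intro closedin_zariski_zeros assms)
  then show ?thesis by (simp only: split_paired_All fst_conv snd_conv vec_eq_iff zero_index)
qed

lemma closedin_LP_variety: "closedin zariski LP_variety"
proof -
  let ?C = "\<lambda>x y z T. fst T x y - fst T y x :: vec2"
  let ?A = "\<lambda>x y z T. fst T (fst T x y) z - fst T x (fst T y z) :: vec2"
  let ?L = "\<lambda>x y z T. snd T (snd T x y) z - (snd T (snd T x z) y + snd T x (snd T y z)) :: vec2"
  let ?P = "\<lambda>x y z T. snd T (fst T x y) z - (fst T (snd T x z) y + fst T x (snd T y z)) :: vec2"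
  let ?V = "\<lambda>f. {T \<in> Bil \<times> Bil. \<forall>x y z :: vec2. f x y z T = (0::vec2)}"
  have "closedin zariski (?V ?C \<inter> ?V ?A \<inter> ?V ?L \<inter> ?V ?P)"
    by (intro closedin_Int closedin_zariski_identity;
        unfold vector_minus_component vector_add_component;
        intro regular_diff regular_add regular_fst regular_snd regular_const)
  moreover have "LP_variety = ?V ?C \<inter> ?V ?A \<inter> ?V ?L \<inter> ?V ?P"
  proof (intro set_eqI)
    fix T :: "bil \<times> bil"
    obtain \<mu> \<nu> where "T = (\<mu>, \<nu>)" by (cases T)
    then show "T \<in> LP_variety \<longleftrightarrow> T \<in> ?V ?C \<inter> ?V ?A \<inter> ?V ?L \<inter> ?V ?P"
      by (simp only: LP_variety_iff Int_iff mem_Collect_eq fst_conv snd_conv mem_Times_iff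
          right_minus_eq) blast
  qed
  ultimately show ?thesis by simp
qed

text \<open>\<open>D\<close> is the determinant of \<open>g\<close>; conditions homogeneous in
  wedges are therefore invariant under GL(V).\<close>

lemma wedge_GL_V:
  assumes "g \<in> GL_V" obtains D where "\<And>x y. wedge (g x) (g y) = D * wedge x y"
proof -
  obtain u w where "wedge u w \<noteq> 0" "g = frame u w" using assms by (rule GL_V_frame)
  then show ?thesis
    by (intro that[of "wedge u w"]) (simp add: wedge_def frame_def algebra_simps)
qed

subsection \<open>Irreducibility\<close>

text \<open>Off the zeros of \<open>D\<close>, the function is an element of the localisation of
  C[t] at \<open>D\<close>; at these zeros its values are arbitrary. Fixing the base of the
  denominators in advance makes sums and products easy.\<close>

definition rational_with :: "complex poly \<Rightarrow> (complex \<Rightarrow> complex) \<Rightarrow> bool" where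
  "rational_with D f \<longleftrightarrow> (\<exists>P n. \<forall>t. poly D t \<noteq> 0 \<longrightarrow> f t = poly P t / poly D t ^ n)"

lemma rational_with_poly [intro]: "rational_with D (poly P)"
  unfolding rational_with_def by (intro exI[of _ P] exI[of _ 0]) simp

lemma rational_with_const [intro]: "rational_with D (\<lambda>_. c)"
  using rational_with_poly[of D "[:c:]"] by (simp add: rational_with_def)

lemma rational_with_inverse: "rational_with D (\<lambda>t. 1 / poly D t)"
  unfolding rational_with_def by (intro exI[of _ 1] exI[of _ 1]) simp

lemma rational_with_add [intro]:
  assumes "rational_with D f" "rational_with D g" shows "rational_with D (\<lambda>t. f t + g t)"
proof -
  obtain P n Q m where "\<forall>t. poly D t \<noteq> 0 \<longrightarrow> f t = poly P t / poly D t ^ n"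
    "\<forall>t. poly D t \<noteq> 0 \<longrightarrow> g t = poly Q t / poly D t ^ m"
    using assms unfolding rational_with_def by blast
  then show ?thesis unfolding rational_with_def
    by (intro exI[of _ "P * D ^ m + Q * D ^ n"] exI[of _ "n + m"])
       (simp add: power_add add_divide_distrib)
qed

lemma rational_with_mult [intro]:
  assumes "rational_with D f" "rational_with D g" shows "rational_with D (\<lambda>t. f t * g t)"
proof -
  obtain P n Q m where "\<forall>t. poly D t \<noteq> 0 \<longrightarrow> f t = poly P t / poly D t ^ n"
    "\<forall>t. poly D t \<noteq> 0 \<longrightarrow> g t = poly Q t / poly D t ^ m"
    using assms unfolding rational_with_def by blast
  then show ?thesis unfolding rational_with_def
    by (intro exI[of _ "P * Q"] exI[of _ "n + m"]) (simp add: power_add)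
qed

lemma rational_with_diff [intro]:
  assumes "rational_with D f" "rational_with D g" shows "rational_with D (\<lambda>t. f t - g t)"
  using rational_with_add[OF assms(1) rational_with_mult[OF rational_with_const[of _ "-1"] assms(2)]]
  by simp

lemma rational_with_cong:
  assumes "rational_with D f" "\<And>t. poly D t \<noteq> 0 \<Longrightarrow> g t = f t" shows "rational_with D g"
  using assms unfolding rational_with_def by metis

definition rational_curve :: "complex poly \<Rightarrow> (complex \<Rightarrow> bil \<times> bil) \<Rightarrow> bool" where
  "rational_curve D \<gamma> \<longleftrightarrow> (\<forall>i j k. rational_with D (\<lambda>t. fst (\<gamma> t) (axis i 1) (axis j 1) $ k)
     \<and> rational_with D (\<lambda>t. snd (\<gamma> t) (axis i 1) (axis j 1) $ k))"

lemma rational_with_polynomial_fun: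
  assumes "polynomial_fun p" "rational_curve D \<gamma>" shows "rational_with D (\<lambda>t. p (\<gamma> t))"
  using assms(1)
proof induction
  case (coord_prd i j k)
  then show ?case using assms(2) by (simp add: rational_curve_def case_prod_unfold)
next
  case (coord_brk i j k)
  then show ?case using assms(2) by (simp add: rational_curve_def case_prod_unfold)
qed auto

text \<open>A set any two of whose points lie on a rational curve \<open>\<gamma>\<close> inside it is irreducible: if
  \<open>p\<close> and \<open>q\<close> do not vanish at \<open>\<gamma> 0\<close> and \<open>\<gamma> 1\<close>, then \<open>p \<circ> \<gamma>\<close> and \<open>q \<circ> \<gamma>\<close> are nonzero rational
  functions, and so is their product.\<close>

lemma irreducible_in_rational_curves:
  assumes "S \<subseteq> Bil \<times> Bil" "S \<noteq> {}"
    and "\<And>x y. x \<in> S \<Longrightarrow> y \<in> S \<Longrightarrow> \<exists>D \<gamma>. rational_curve D \<gamma> \<and> poly D 0 \<noteq> 0 \<and> poly D 1 \<noteq> 0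
      \<and> \<gamma> 0 = x \<and> \<gamma> 1 = y \<and> (\<forall>t. poly D t \<noteq> 0 \<longrightarrow> \<gamma> t \<in> S)"
  shows "irreducible_in zariski S"
  unfolding irreducible_in_def
proof (intro conjI allI impI)
  show "S \<subseteq> topspace zariski" "S \<noteq> {}" using assms by (simp_all add: topspace_zariski)
  fix A B assume AB: "closedin zariski A \<and> closedin zariski B \<and> S \<subseteq> A \<union> B"
  show "S \<subseteq> A \<or> S \<subseteq> B"
  proof (rule ccontr)
    assume "\<not> (S \<subseteq> A \<or> S \<subseteq> B)"
    then obtain x y where xy: "x \<in> S" "x \<notin> A" "y \<in> S" "y \<notin> B" by blast
    obtain P where P: "\<forall>p\<in>P. polynomial_fun p" "A = {T \<in> Bil \<times> Bil. \<forall>p\<in>P. p T = 0}"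
      using AB[THEN conjunct1] unfolding closedin_zariski zariski_closed_def by (elim exE conjE)
    obtain Q where Q: "\<forall>p\<in>Q. polynomial_fun p" "B = {T \<in> Bil \<times> Bil. \<forall>p\<in>Q. p T = 0}"
      using AB[THEN conjunct2, THEN conjunct1] unfolding closedin_zariski zariski_closed_def
      by (elim exE conjE)
    have "x \<in> Bil \<times> Bil" "y \<in> Bil \<times> Bil" using xy assms(1) by auto
    with xy(2,4) have "\<exists>p\<in>P. p x \<noteq> 0" "\<exists>q\<in>Q. q y \<noteq> 0"
      unfolding P(2) Q(2) mem_Collect_eq by blast+
    then obtain p q where "p \<in> P" "p x \<noteq> 0" "q \<in> Q" "q y \<noteq> 0" by blast
    moreover from this have "\<And>T. T \<in> A \<Longrightarrow> p T = 0" "\<And>T. T \<in> B \<Longrightarrow> q T = 0"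
      unfolding P(2) Q(2) by simp_all
    ultimately have p: "polynomial_fun p" "p x \<noteq> 0" "\<And>T. T \<in> A \<Longrightarrow> p T = 0"
      and q: "polynomial_fun q" "q y \<noteq> 0" "\<And>T. T \<in> B \<Longrightarrow> q T = 0"
      using P(1) Q(1) by simp_all
    obtain D \<gamma> where \<gamma>: "rational_curve D \<gamma>" "poly D 0 \<noteq> 0" "poly D 1 \<noteq> 0" "\<gamma> 0 = x" "\<gamma> 1 = y"
      "\<And>t. poly D t \<noteq> 0 \<Longrightarrow> \<gamma> t \<in> S"
      using assms(3)[OF xy(1,3)] by blast
    obtain F n where F: "\<And>t. poly D t \<noteq> 0 \<Longrightarrow> p (\<gamma> t) = poly F t / poly D t ^ n"
      using rational_with_polynomial_fun[OF p(1) \<gamma>(1)] unfolding rational_with_def by blast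
    obtain G m where G: "\<And>t. poly D t \<noteq> 0 \<Longrightarrow> q (\<gamma> t) = poly G t / poly D t ^ m"
      using rational_with_polynomial_fun[OF q(1) \<gamma>(1)] unfolding rational_with_def by blast
    \<comment> \<open>The factor \<open>D\<close> absorbs the parameters at which the curve is not
      controlled, so the product vanishes on the whole infinite field.\<close>
    have "poly (D * F * G) t = 0" for t
    proof (cases "poly D t = 0")
      case False
      then have "\<gamma> t \<in> A \<union> B" using \<gamma>(6) AB by (meson subsetD)
      then have "p (\<gamma> t) = 0 \<or> q (\<gamma> t) = 0" using p(3)[of "\<gamma> t"] q(3)[of "\<gamma> t"] by blast
      then have "poly F t = 0 \<or> poly G t = 0"
        unfolding F[OF False] G[OF False] using False by (simp only: divide_eq_0_iff) simp
      then show ?thesis unfolding poly_mult by (elim disjE) simp_all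
    qed simp
    then have "D * F * G = 0" by (intro iffD1[OF poly_all_0_iff_0] allI)
    moreover have "D \<noteq> 0" using \<gamma>(2) by (rule contrapos_nn) simp
    moreover have "F \<noteq> 0"
    proof
      assume "F = 0"
      with F[OF \<gamma>(2)] have "p (\<gamma> 0) = 0" by simp
      with \<gamma>(4) p(2) show False by simp
    qed
    moreover have "G \<noteq> 0"
    proof
      assume "G = 0"
      with G[OF \<gamma>(3)] have "q (\<gamma> 1) = 0" by simp
      with \<gamma>(5) q(2) show False by simp
    qed
    ultimately show False by simp
  qed
qed

lemma rational_with_Bil_apply:
  assumes "\<And>t. \<mu> t \<in> Bil" "\<And>i j k. rational_with D (\<lambda>t. \<mu> t (axis i 1) (axis j 1) $ k)"
    "\<And>k. rational_with D (\<lambda>t. x t $ k)" "\<And>k. rational_with D (\<lambda>t. y t $ k)"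
  shows "rational_with D (\<lambda>t. \<mu> t (x t) (y t) $ k)"
proof (rule rational_with_cong)
  show "\<mu> t (x t) (y t) $ k = x t $ 1 * y t $ 1 * \<mu> t e\<^sub>1 e\<^sub>1 $ k
      + x t $ 1 * y t $ 2 * \<mu> t e\<^sub>1 e\<^sub>2 $ k + x t $ 2 * y t $ 1 * \<mu> t e\<^sub>2 e\<^sub>1 $ k
      + x t $ 2 * y t $ 2 * \<mu> t e\<^sub>2 e\<^sub>2 $ k" for t
    by (intro Bil_apply assms)
  show "rational_with D (\<lambda>t. x t $ 1 * y t $ 1 * \<mu> t e\<^sub>1 e\<^sub>1 $ k
      + x t $ 1 * y t $ 2 * \<mu> t e\<^sub>1 e\<^sub>2 $ k + x t $ 2 * y t $ 1 * \<mu> t e\<^sub>2 e\<^sub>1 $ k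
      + x t $ 2 * y t $ 2 * \<mu> t e\<^sub>2 e\<^sub>2 $ k)"
    by (intro rational_with_add rational_with_mult assms)
qed

text \<open>Two points are joined by moving the matrix and the parameter \<alpha> along straight
  lines simultaneously. The determinant \<open>D\<close> of the moving matrix is a polynomial that
  is nonzero at both ends, and by Cramer's rule it is the only denominator. A zero map \<nu>' yields
  the case of a single orbit.\<close>

lemma irreducible_in_orbits:
  assumes "\<mu> \<in> Bil" "\<nu> \<in> Bil" "\<nu>' \<in> Bil"
  shows "irreducible_in zariski (\<Union>\<alpha>. orbit (\<mu>, \<lambda>x y. \<nu> x y + \<alpha> *s \<nu>' x y))"
proof -
  define L where "L \<alpha> = (\<mu>, \<lambda>x y. \<nu> x y + \<alpha> *s \<nu>' x y)" for \<alpha>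
  have L: "L \<alpha> \<in> Bil \<times> Bil" for \<alpha>
    using assms unfolding L_def Bil_def bilinear_map_def Vector_Spaces.linear_iff
    by (simp add: vec_eq_iff algebra_simps)
  have "irreducible_in zariski (\<Union>\<alpha>. orbit (L \<alpha>))"
  proof (rule irreducible_in_rational_curves)
    show "(\<Union>\<alpha>. orbit (L \<alpha>)) \<subseteq> Bil \<times> Bil"
      using act_in_Bil L unfolding orbit_def by blast
    show "(\<Union>\<alpha>. orbit (L \<alpha>)) \<noteq> {}" using self_in_orbit by blast
    fix S T assume "S \<in> (\<Union>\<alpha>. orbit (L \<alpha>))" "T \<in> (\<Union>\<alpha>. orbit (L \<alpha>))"
    then obtain \<alpha> \<beta> g h where "g \<in> GL_V" "h \<in> GL_V" and ST: "S = act g (L \<alpha>)" "T = act h (L \<beta>)"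
      unfolding orbit_def by blast
    obtain u w where g: "wedge u w \<noteq> 0" "g = frame u w" using \<open>g \<in> GL_V\<close> by (rule GL_V_frame)
    obtain u' w' where h: "wedge u' w' \<noteq> 0" "h = frame u' w'" using \<open>h \<in> GL_V\<close> by (rule GL_V_frame)
    define U where "U t = u + t *s (u' - u)" for t
    define W where "W t = w + t *s (w' - w)" for t
    define A where "A t = \<alpha> + t * (\<beta> - \<alpha>)" for t
    define line where "line a b = [:a, b - a:]" for a b :: complex
    have line: "poly (line a b) t = a + t * (b - a)" for a b t by (simp add: line_def)
    define D where "D = line (u $ 1) (u' $ 1) * line (w $ 2) (w' $ 2)
      - line (u $ 2) (u' $ 2) * line (w $ 1) (w' $ 1)"
    have D: "poly D t = wedge (U t) (W t)" for t
      by (simp add: D_def line wedge_def U_def W_def right_diff_distrib)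
    define \<gamma> where "\<gamma> t = act (frame (U t) (W t)) (L (A t))" for t
    have affine: "rational_with D (\<lambda>t. a + (t * b - t * a))" for a b
    proof -
      have "poly (line a b) = (\<lambda>t. a + (t * b - t * a))" by (simp add: line fun_eq_iff right_diff_distrib)
      then show ?thesis using rational_with_poly[of D "line a b"] by simp
    qed
    have lines: "rational_with D (\<lambda>t. U t $ k)" "rational_with D (\<lambda>t. W t $ k)"
      "rational_with D A" for k
      using affine by (simp_all add: U_def W_def A_def[abs_def] right_diff_distrib)
    have coframe: "rational_with D (\<lambda>t. coframe (U t) (W t) x $ k)" for x k
    proof -
      have "rational_with D (\<lambda>t. (wedge x (W t) * (1 / poly D t)) * e\<^sub>1 $ k
          + (wedge (U t) x * (1 / poly D t)) * e\<^sub>2 $ k)"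
        unfolding wedge_def
        by (intro rational_with_add rational_with_mult rational_with_diff rational_with_const
            rational_with_inverse lines)
      then show ?thesis by (simp add: coframe_def D)
    qed
    have act: "rational_with D (\<lambda>t. frame (U t) (W t)
        (\<mu> t (coframe (U t) (W t) x) (coframe (U t) (W t) y)) $ k)"
      if "\<And>t. \<mu> t \<in> Bil" "\<And>i j k. rational_with D (\<lambda>t. \<mu> t (axis i 1) (axis j 1) $ k)" for \<mu> x y k
      unfolding frame_def vector_add_component vector_smult_component
      by (intro rational_with_add rational_with_mult lines
          rational_with_Bil_apply[OF that] coframe)
    have "rational_curve D \<gamma>"
      unfolding rational_curve_def
    proof (intro conjI allI)
      fix i j k :: 2
      have eq: "fst (\<gamma> t) (axis i 1) (axis j 1) = frame (U t) (W t) (fst (L (A t))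
            (coframe (U t) (W t) (axis i 1)) (coframe (U t) (W t) (axis j 1)))"
          "snd (\<gamma> t) (axis i 1) (axis j 1) = frame (U t) (W t) (snd (L (A t))
            (coframe (U t) (W t) (axis i 1)) (coframe (U t) (W t) (axis j 1)))"
        if "poly D t \<noteq> 0" for t
        using that by (simp_all add: \<gamma>_def act_def D inv_frame case_prod_unfold)
      have Bil: "fst (L t) \<in> Bil" "snd (L t) \<in> Bil" for t
        using L[of t] by (simp_all add: mem_Times_iff)
      have coords: "rational_with D (\<lambda>t. fst (L (A t)) (axis i 1) (axis j 1) $ k)"
        "rational_with D (\<lambda>t. snd (L (A t)) (axis i 1) (axis j 1) $ k)" for i j k
        unfolding L_def fst_conv snd_conv vector_add_component vector_smult_component
        by (intro rational_with_add rational_with_mult rational_with_const lines)+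
      note fst = act[of "\<lambda>t. fst (L (A t))", OF Bil(1) coords(1)]
        and snd = act[of "\<lambda>t. snd (L (A t))", OF Bil(2) coords(2)]
      show "rational_with D (\<lambda>t. fst (\<gamma> t) (axis i 1) (axis j 1) $ k)"
        by (rule rational_with_cong[OF fst]) (simp add: eq)
      show "rational_with D (\<lambda>t. snd (\<gamma> t) (axis i 1) (axis j 1) $ k)"
        by (rule rational_with_cong[OF snd]) (simp add: eq)
    qed
    moreover have "poly D 0 \<noteq> 0" "poly D 1 \<noteq> 0" "\<gamma> 0 = S" "\<gamma> 1 = T"
      using g h by (simp_all add: D \<gamma>_def U_def W_def A_def ST)
    moreover have "\<gamma> t \<in> (\<Union>\<alpha>. orbit (L \<alpha>))" if "poly D t \<noteq> 0" for t
      using that frame_in_GL_V unfolding \<gamma>_def D orbit_def by blast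
    ultimately show "\<exists>D \<gamma>. rational_curve D \<gamma> \<and> poly D 0 \<noteq> 0 \<and> poly D 1 \<noteq> 0
      \<and> \<gamma> 0 = S \<and> \<gamma> 1 = T \<and> (\<forall>t. poly D t \<noteq> 0 \<longrightarrow> \<gamma> t \<in> (\<Union>\<alpha>. orbit (L \<alpha>)))"
      by blast
  qed
  then show ?thesis unfolding L_def .
qed

subsection \<open>Degenerations\<close>

lemma tendsto_polynomial_fun:
  assumes "polynomial_fun p"
    and "\<And>i j k. ((\<lambda>t. fst (\<gamma> t) (axis i 1) (axis j 1) $ k) \<longlongrightarrow> fst T (axis i 1) (axis j 1) $ k) F"
    and "\<And>i j k. ((\<lambda>t. snd (\<gamma> t) (axis i 1) (axis j 1) $ k) \<longlongrightarrow> snd T (axis i 1) (axis j 1) $ k) F"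
  shows "((\<lambda>t. p (\<gamma> t)) \<longlongrightarrow> p T) F"
  using assms(1)
proof induction
  case (coord_prd i j k)
  then show ?case using assms(2) by (simp add: case_prod_unfold)
next
  case (coord_brk i j k)
  then show ?case using assms(3) by (simp add: case_prod_unfold)
qed (auto intro: tendsto_const tendsto_add tendsto_mult)

lemma closed_degeneration:
  assumes "closedin zariski C" "g \<in> GL_V" "T \<in> Bil \<times> Bil"
    and "\<And>t. t \<noteq> 0 \<Longrightarrow> act g (\<gamma> t) \<in> C"
    and "\<And>x y k. (\<lambda>t. fst (\<gamma> t) x y $ k) \<midarrow>0\<rightarrow> fst T x y $ k"
    and "\<And>x y k. (\<lambda>t. snd (\<gamma> t) x y $ k) \<midarrow>(0::complex)\<rightarrow> snd T x y $ k"
  shows "act g T \<in> C"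
proof -
  obtain P where P: "\<forall>p\<in>P. polynomial_fun p" "C = {T \<in> Bil \<times> Bil. \<forall>p\<in>P. p T = 0}"
    using assms(1) unfolding closedin_zariski zariski_closed_def by blast
  obtain u w where g: "g = frame u w" using assms(2) by (rule GL_V_frame)
  have "p (act g T) = 0" if "p \<in> P" for p
  proof -
    have "((\<lambda>t. p (act g (\<gamma> t))) \<longlongrightarrow> p (act g T)) (at 0)"
    proof (rule tendsto_polynomial_fun)
      show "polynomial_fun p" using P that by blast
    qed (unfold act_def case_prod_unfold fst_conv snd_conv g frame_def vector_add_component
        vector_smult_component, (intro tendsto_add tendsto_mult tendsto_const assms(5,6))+)
    moreover have "((\<lambda>t. p (act g (\<gamma> t))) \<longlongrightarrow> 0) (at 0)"
      using assms(4) P that by (intro tendsto_eventually) (auto simp: eventually_at_filter)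
    ultimately show ?thesis by (rule tendsto_unique[OF at_neq_bot])
  qed
  with act_in_Bil[OF assms(2,3)] show ?thesis unfolding P(2) by blast
qed

subsection \<open>Normal forms\<close>

lemma LP_varietyD:
  assumes "(\<mu>, \<nu>) \<in> LP_variety"
  shows "\<mu> \<in> Bil" "\<nu> \<in> Bil" "\<mu> x y = \<mu> y x" "\<mu> (\<mu> x y) z = \<mu> x (\<mu> y z)"
    "\<nu> (\<nu> x y) z = \<nu> (\<nu> x z) y + \<nu> x (\<nu> y z)"
    "\<nu> (\<mu> x y) z = \<mu> (\<nu> x z) y + \<mu> x (\<nu> y z)"
  using assms unfolding LP_variety_iff by blast+

text \<open>Only the product is normalised; the bracket is rewritten in the new basis, and it still
  satisfies the identities because the variety is stable under GL(V).\<close>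

lemma product_in_basis:
  assumes "wedge u w \<noteq> 0" "(\<mu>, \<nu>) \<in> LP_variety"
    and "\<mu> u u = frame u w a" "\<mu> u w = frame u w b" "\<mu> w w = frame u w d"
  shows "\<exists>g\<in>GL_V. \<exists>\<nu>'. (\<mu>, \<nu>) = act g (bil_table a b b d, \<nu>') \<and> (bil_table a b b d, \<nu>') \<in> LP_variety"
proof -
  have g: "frame u w \<in> GL_V" by (rule frame_in_GL_V[OF assms(1)])
  define f where "f x = coframe u w x" for x
  have f: "x = frame u w (f x)" for x by (simp add: f_def frame_coframe assms(1))
  have "\<mu> w u = frame u w b" using LP_varietyD(3)[OF assms(2)] assms(4) by simp
  from pair_in_basis[OF assms(1) LP_varietyD(1,2)[OF assms(2)] assms(3,4) this assms(5) f f f f]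
  have eq: "(\<mu>, \<nu>) = act (frame u w) (bil_table a b b d,
      bil_table (f (\<nu> u u)) (f (\<nu> u w)) (f (\<nu> w u)) (f (\<nu> w w)))" .
  then have "(bil_table a b b d, bil_table (f (\<nu> u u)) (f (\<nu> u w)) (f (\<nu> w u)) (f (\<nu> w w)))
      = act (inv (frame u w)) (\<mu>, \<nu>)"
    by (simp add: act_inv[OF g])
  also have "\<dots> \<in> LP_variety" by (intro act_in_LP_variety GL_V_inv g assms)
  finally show ?thesis using eq g by blast
qed

text \<open>The factorisation X^2 - q X - p = (X - r) (X - s) over the complex numbers.\<close>

lemma quadratic_roots:
  obtains r s :: complex where "q = r + s" "p = - r * s"
proof
  define d where "d = csqrt (q\<^sup>2 + 4 * p)"
  have "d * d = q\<^sup>2 + 4 * p" by (simp add: d_def flip: power2_eq_square)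
  then show "q = (q + d) / 2 + (q - d) / 2" "p = - ((q + d) / 2) * ((q - d) / 2)"
    by (simp_all add: field_simps power2_eq_square)
qed

lemma wedge_linear:
  "wedge (x + y) z = wedge x z + wedge y z" "wedge z (x + y) = wedge z x + wedge z y"
  "wedge (x - y) z = wedge x z - wedge y z" "wedge z (x - y) = wedge z x - wedge z y"
  "wedge (c *s x) z = c * wedge x z" "wedge z (c *s x) = c * wedge z x"
  "wedge x x = 0"
  by (simp_all add: wedge_def algebra_simps)

text \<open>If some \<open>v\<close> is independent of \<open>v\<^sup>2\<close>, then \<open>v\<close> generates the algebra, with minimal equation
  \<open>v\<^sup>3 = (r + s) v\<^sup>2 - r s v\<close>; the multiplicities of the roots \<open>0, r, s\<close> determine the product.\<close>

lemma cyclic_product: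
  assumes LP: "(\<mu>, \<nu>) \<in> LP_variety" and v: "wedge v (\<mu> v v) \<noteq> 0"
  shows "\<exists>g\<in>GL_V. \<exists>M \<nu>'. (\<mu>, \<nu>) = act g (M, \<nu>') \<and> (M, \<nu>') \<in> LP_variety \<and>
    M \<in> {bil_table e\<^sub>1 0 0 e\<^sub>2, bil_table e\<^sub>1 e\<^sub>2 e\<^sub>2 0, bil_table e\<^sub>1 0 0 0, bil_table e\<^sub>2 0 0 0}"
proof -
  note D = LP_varietyD[OF LP] and add = Bil_add[OF LP_varietyD(1)[OF LP]]
  define w where "w = \<mu> v v"
  have vw0: "wedge v w \<noteq> 0" using v by (simp add: w_def)
  have wv0: "wedge w v = - wedge v w" by (simp add: wedge_def)
  obtain r s where rs: "coframe v w (\<mu> v w) $ 2 = r + s" "coframe v w (\<mu> v w) $ 1 = - r * s"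
    using quadratic_roots by metis
  have vv: "\<mu> v v = w" by (simp add: w_def)
  have vw: "\<mu> v w = (r + s) *s w - (r * s) *s v"
    using frame_coframe[OF vw0, of "\<mu> v w"] rs by (simp add: frame_def)
  have wv: "\<mu> w v = (r + s) *s w - (r * s) *s v" using D(3) vw by metis
  have "\<mu> w w = \<mu> v (\<mu> v w)" by (metis D(4) vv)
  then have ww: "\<mu> w w = (r + s) *s ((r + s) *s w - (r * s) *s v) - (r * s) *s w"
    unfolding vw add using vv vw by simp
  note mult = add vv vw wv ww
  \<comment> \<open>The multiplicities of the roots 0, r, s: all distinct, a double nonzero root, 0
    double beside a nonzero root t, 0 triple.\<close>
  consider "r \<noteq> s" "r \<noteq> 0" "s \<noteq> 0" | "r = s" "r \<noteq> 0"
    | t where "t \<noteq> 0" "r + s = t" "r * s = 0" | "r = 0" "s = 0"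
    by force
  then show ?thesis
  proof cases
    case 1
    \<comment> \<open>Lagrange interpolation with v as x: x (x - s) / (r (r - s)) is 1 at r and 0 at
      0 and s, and f is its counterpart at s. They are orthogonal idempotents.\<close>
    define e f where "e = (1 / (r * (r - s))) *s (w - s *s v)"
      and "f = (1 / (s * (s - r))) *s (w - r *s v)"
    have "wedge (w - s *s v) (w - r *s v) = (r - s) * wedge v w"
      by (simp add: wedge_linear wv0 algebra_simps)
    then have ef: "wedge e f \<noteq> 0"
      unfolding e_def f_def wedge_linear(5,6) using 1 vw0 by simp
    have "\<mu> (w - s *s v) (w - s *s v) = (r * (r - s)) *s (w - s *s v)"
      "\<mu> (w - r *s v) (w - r *s v) = (s * (s - r)) *s (w - r *s v)"
      "\<mu> (w - s *s v) (w - r *s v) = 0"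
      unfolding mult by (simp_all add: vec_eq_iff algebra_simps)
    then have "\<mu> e e = frame e f e\<^sub>1" "\<mu> e f = frame e f 0" "\<mu> f f = frame e f e\<^sub>2"
      unfolding e_def f_def frame_axis add(3,4) using 1 by (simp_all add: frame_def)
    from product_in_basis[OF ef LP this] show ?thesis by blast
  next
    case 2
    \<comment> \<open>x (2 r - x) / r^2 vanishes at 0 and equals 1 to second order at r, so it is
      the unit of the ideal (x); x (x - r) is nilpotent.\<close>
    define e f where "e = (1 / r\<^sup>2) *s ((2 * r) *s v - w)" and "f = w - r *s v"
    have "wedge ((2 * r) *s v - w) f = r * wedge v w"
      by (simp add: f_def wedge_linear wv0)
    then have ef: "wedge e f \<noteq> 0"
      unfolding e_def wedge_linear(5) using 2 vw0 by simp
    have "\<mu> ((2 * r) *s v - w) ((2 * r) *s v - w) = r\<^sup>2 *s ((2 * r) *s v - w)"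
      "\<mu> ((2 * r) *s v - w) f = r\<^sup>2 *s f" and ff: "\<mu> f f = 0"
      unfolding f_def mult 2(1)[symmetric]
      by (simp_all add: vec_eq_iff algebra_simps power2_eq_square)
    then have "\<mu> e e = frame e f e\<^sub>1" "\<mu> e f = frame e f e\<^sub>2"
      unfolding e_def frame_axis add(3,4) using 2 by simp_all
    moreover have "\<mu> f f = frame e f 0" using ff by (simp add: frame_def)
    ultimately show ?thesis using product_in_basis[OF ef LP] by blast
  next
    case 3
    \<comment> \<open>x^2 / t^2 is 1 at t and has a double zero at 0, hence is idempotent; x (t - x)
      spans the annihilator.\<close>
    define e f where "e = (1 / t\<^sup>2) *s w" and "f = t *s v - w"
    have "wedge w f = - t * wedge v w"
      by (simp add: f_def wedge_linear wv0)
    then have ef: "wedge e f \<noteq> 0"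
      unfolding e_def wedge_linear(5) using 3 vw0 by simp
    have "\<mu> w w = t\<^sup>2 *s w" "\<mu> w f = 0" and ff: "\<mu> f f = 0"
      unfolding f_def mult 3 by (simp_all add: vec_eq_iff algebra_simps power2_eq_square)
    then have "\<mu> e e = frame e f e\<^sub>1" "\<mu> e f = frame e f 0"
      unfolding e_def frame_axis add(3,4) using 3 by (simp_all add: frame_def)
    moreover have "\<mu> f f = frame e f 0" using ff by (simp add: frame_def)
    ultimately show ?thesis using product_in_basis[OF ef LP] by blast
  next
    case 4
    then have "\<mu> v v = frame v w e\<^sub>2" "\<mu> v w = frame v w 0" "\<mu> w w = frame v w 0"
      using vv vw ww by (simp_all add: frame_def)
    from product_in_basis[OF vw0 LP this] show ?thesis by blast
  qed
qed

text \<open>The four test vectors give v^2 = \<lambda>(v) v with a linear form \<lambda>, hence 2 x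
  y = \<lambda>(x) y + \<lambda>(y) x. Associativity then equates the square of each coordinate of b
  with its double.\<close>

lemma noncyclic_product:
  assumes LP: "(\<mu>, \<nu>) \<in> LP_variety" and v: "\<And>v. wedge v (\<mu> v v) = 0"
  shows "\<mu> = bil_table 0 0 0 0"
proof -
  note D = LP_varietyD[OF LP]
  obtain a b c d where \<mu>: "\<mu> = bil_table a b c d" using D(1) by (rule Bil_cases)
  have c: "c = b" using D(3)[of e\<^sub>1 e\<^sub>2] by (simp add: \<mu>)
  have a2: "a $ 2 = 0" and d1: "d $ 1 = 0" using v[of e\<^sub>1] v[of e\<^sub>2] by (simp_all add: \<mu> wedge_def)
  have "d $ 2 + 2 * b $ 2 = a $ 1 + 2 * b $ 1" "a $ 1 + d $ 2 = 2 * b $ 1 + 2 * b $ 2"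
    using v[of "e\<^sub>1 + e\<^sub>2"] v[of "e\<^sub>1 - e\<^sub>2"]
    by (simp_all add: \<mu> wedge_def bil_table_def c a2 d1 algebra_simps)
  then have ab: "a $ 1 = 2 * b $ 2" "d $ 2 = 2 * b $ 1"
    by algebra+
  have "b $ 2 = 0" "b $ 1 = 0"
    using arg_cong[OF D(4)[of e\<^sub>1 e\<^sub>1 e\<^sub>2], of "\<lambda>v. v $ 2"]
      arg_cong[OF D(4)[of e\<^sub>1 e\<^sub>2 e\<^sub>2], of "\<lambda>v. v $ 1"]
    by (simp_all add: \<mu> bil_table_def c a2 d1 ab)
  then show ?thesis using a2 d1 ab by (simp add: \<mu> c vec_eq_iff forall_2 bil_table_eq_iff)
qed

text \<open>A derivation d kills an idempotent e, since d(e) = 2 e d(e) and multiplication by e has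
  only the eigenvalues 0 and 1. In the second and third tables it maps \<open>e\<^sub>2\<close> to a
  multiple of itself. In the last one \<open>e\<^sub>2\<close> is a square, so
  [\<open>e\<^sub>2\<close>, z] is determined by [\<open>e\<^sub>1\<close>, z].\<close>

lemma bracket_of_table:
  assumes "(M, \<nu>) \<in> LP_variety"
  shows "M = bil_table e\<^sub>1 0 0 e\<^sub>2 \<Longrightarrow> (M, \<nu>) = L\<^sub>4"
    and "M = bil_table e\<^sub>1 e\<^sub>2 e\<^sub>2 0 \<Longrightarrow> \<exists>\<alpha>. (M, \<nu>) = L\<^sub>5 \<alpha>"
    and "M = bil_table e\<^sub>1 0 0 0 \<Longrightarrow> \<exists>\<alpha>. (M, \<nu>) = L\<^sub>6 \<alpha>"
    and "M = bil_table e\<^sub>2 0 0 0 \<Longrightarrow> \<exists>\<beta>. \<nu> = bil_table (\<beta> *s e\<^sub>2) 0 0 0"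
proof -
  note D = LP_varietyD[OF assms]
  note table = Bil_eq_table[OF D(2)] and add = Bil_add[OF D(2)]
  \<comment> \<open>In the Leibniz identity with equal last arguments, [[x, y], y] cancels.\<close>
  have square_zero: "\<nu> x (\<nu> y y) = 0" for x y
    using D(5)[of x y y] by simp
  have e2_derivation: "\<exists>\<alpha>. \<nu> = bil_table 0 0 (\<alpha> *s e\<^sub>2) 0"
    if 1: "\<And>z. \<nu> e\<^sub>1 z = 0" and 2: "\<And>z. \<nu> e\<^sub>2 z $ 1 = 0"
  proof -
    obtain \<alpha> \<beta> where *: "\<nu> e\<^sub>2 e\<^sub>1 = \<alpha> *s e\<^sub>2" "\<nu> e\<^sub>2 e\<^sub>2 = \<beta> *s e\<^sub>2"
      using 2 vec2_expand by (metis add.left_neutral vector_smult_lzero)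
    have "\<beta> = 0" using square_zero[of e\<^sub>2 e\<^sub>2] by (simp add: * add)
    then show ?thesis using table 1 * by (intro exI[of _ \<alpha>]) simp
  qed
  note coords = vec_eq_iff forall_2 bil_table_def
  show "(M, \<nu>) = L\<^sub>4" if M: "M = bil_table e\<^sub>1 0 0 e\<^sub>2"
  proof -
    have "\<nu> e\<^sub>1 z = 0" "\<nu> e\<^sub>2 z = 0" for z
      using D(6)[of e\<^sub>1 e\<^sub>1 z] D(6)[of e\<^sub>2 e\<^sub>2 z] by (simp_all add: M coords)
    then show ?thesis using table by (simp add: L\<^sub>4_def M)
  qed
  show "\<exists>\<alpha>. (M, \<nu>) = L\<^sub>5 \<alpha>" if M: "M = bil_table e\<^sub>1 e\<^sub>2 e\<^sub>2 0"
  proof -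
    have "\<nu> e\<^sub>1 z = 0" "\<nu> e\<^sub>2 z $ 1 = 0" for z
      using D(6)[of e\<^sub>1 e\<^sub>1 z] D(6)[of e\<^sub>2 e\<^sub>2 z] Bil_add(3)[OF D(2), of 0 0 z]
      by (simp_all add: M coords)
    from e2_derivation[OF this] show ?thesis by (simp add: M L\<^sub>5_def)
  qed
  show "\<exists>\<alpha>. (M, \<nu>) = L\<^sub>6 \<alpha>" if M: "M = bil_table e\<^sub>1 0 0 0"
  proof -
    have 1: "\<nu> e\<^sub>1 z = 0" for z
      using D(6)[of e\<^sub>1 e\<^sub>1 z] by (simp add: M coords)
    have "\<nu> e\<^sub>2 z $ 1 = 0" for z
      using D(6)[of e\<^sub>1 e\<^sub>2 z] Bil_add(3)[OF D(2), of 0 0 z] 1[of z] by (simp add: M coords)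
    from e2_derivation[OF 1 this] show ?thesis by (simp add: M L\<^sub>6_def)
  qed
  show "\<exists>\<beta>. \<nu> = bil_table (\<beta> *s e\<^sub>2) 0 0 0" if M: "M = bil_table e\<^sub>2 0 0 0"
  proof -
    have e2: "\<nu> e\<^sub>2 z = (2 * \<nu> e\<^sub>1 z $ 1) *s e\<^sub>2" for z
      using D(6)[of e\<^sub>1 e\<^sub>1 z] by (simp add: M coords)
    \<comment> \<open>Let c be the first coordinate of [\<open>e\<^sub>1\<close>,
      \<open>e\<^sub>2\<close>]. Then [\<open>e\<^sub>2\<close>, \<open>e\<^sub>2\<close>] is 2 c
      times \<open>e\<^sub>2\<close>, so \<open>square_zero\<close> kills 2 c
      [\<open>e\<^sub>1\<close>, \<open>e\<^sub>2\<close>], whose first coordinate is 2 c^2. The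
      coefficients a and d below vanish through their squares too.\<close>
    have "\<nu> e\<^sub>1 e\<^sub>2 $ 1 *s \<nu> e\<^sub>1 e\<^sub>2 = 0"
      using square_zero[of e\<^sub>1 e\<^sub>2] by (subst (asm) e2) (simp add: add)
    then have c: "\<nu> e\<^sub>1 e\<^sub>2 $ 1 = 0" by (auto simp: vec_eq_iff)
    define a b d where "a = \<nu> e\<^sub>1 e\<^sub>1 $ 1" and "b = \<nu> e\<^sub>1 e\<^sub>1 $ 2" and "d = \<nu> e\<^sub>1 e\<^sub>2 $ 2"
    have 11: "\<nu> e\<^sub>1 e\<^sub>1 = a *s e\<^sub>1 + b *s e\<^sub>2" and 12: "\<nu> e\<^sub>1 e\<^sub>2 = d *s e\<^sub>2"
      using c by (simp_all add: vec_eq_iff forall_2 a_def b_def d_def)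
    have "a = 0"
      using arg_cong[OF square_zero[of e\<^sub>1 e\<^sub>1], of "\<lambda>v. v $ 1"] by (simp add: 11 12 add)
    with 11 12 e2 have 21: "\<nu> e\<^sub>2 e\<^sub>1 = 0" "\<nu> e\<^sub>2 e\<^sub>2 = 0" by simp_all
    have "d *s (d *s e\<^sub>2) = 0"
      using D(5)[of e\<^sub>1 e\<^sub>1 e\<^sub>2] by (simp add: 11 12 21 \<open>a = 0\<close> add)
    then have "d = 0" by simp
    then show ?thesis using table 11 12 21 \<open>a = 0\<close> by (intro exI[of _ b]) simp
  qed
qed

section \<open>Two-dimensional Leibniz algebras\<close>

lemma zero_bil [simp]: "bil_table 0 0 0 0 x y = 0"
  by (simp add: bil_table_def)

lemma parallel_vec2:
  assumes "wedge x y = 0" "x \<noteq> 0" obtains c where "y = c *s x"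
proof (cases "x $ 1 = 0")
  case True
  with assms show ?thesis
    by (intro that[of "y $ 2 / x $ 2"]) (auto simp: wedge_def vec_eq_iff forall_2)
next
  case False
  with assms show ?thesis
    by (intro that[of "y $ 1 / x $ 1"]) (auto simp: wedge_def vec_eq_iff forall_2 field_simps)
qed

text \<open>A skew bracket is determined by v = [\<open>e\<^sub>1\<close>,
  \<open>e\<^sub>2\<close>]. Otherwise some square w = [y, y] is nonzero and [x, w] = 0 for all x;
  then y, w is a basis and only [w, y] = d w remains, with d = 0 and d \<noteq> 0 as the two
  cases.\<close>

lemma leibniz_normal_form:
  assumes LP: "(bil_table 0 0 0 0, \<nu>) \<in> LP_variety" (is "(?Z, _) \<in> _")
  shows "\<exists>g\<in>GL_V. (?Z, \<nu>) = act g L\<^sub>3 \<or> (\<exists>\<beta>. (?Z, \<nu>) = act g (?Z, bil_table (\<beta> *s e\<^sub>2) 0 0 0))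
    \<or> (\<exists>\<delta>. (?Z, \<nu>) = act g (?Z, bil_table 0 0 (\<delta> *s e\<^sub>2) 0))"
proof -
  note D = LP_varietyD[OF LP] and add = Bil_add[OF LP_varietyD(2)[OF LP]]
  have zero: "?Z x y = frame u w 0" for u w x y by (simp add: frame_def)
  note basis = pair_in_basis[OF _ D(1,2) zero zero zero zero]
  show ?thesis
  proof (cases "\<forall>y. \<nu> y y = 0")
    case True
    have anti: "\<nu> x y = - \<nu> y x" for x y
    proof -
      have "\<nu> (x + y) (x + y) = 0" "\<nu> x x = 0" "\<nu> y y = 0" using True by blast+
      then show ?thesis by (simp add: add eq_neg_iff_add_eq_0 add.commute)
    qed
    define v where "v = \<nu> e\<^sub>1 e\<^sub>2"
    have \<nu>: "\<nu> = bil_table 0 v (- v) 0"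
      using Bil_eq_table[OF D(2)] True anti[of e\<^sub>2 e\<^sub>1] by (simp add: v_def)
    have L3: "\<exists>g\<in>GL_V. (?Z, \<nu>) = act g L\<^sub>3" if u: "wedge u v \<noteq> 0" "\<nu> u v = v" for u
    proof -
      have "\<nu> u u = frame u v 0" "\<nu> v v = frame u v 0" "\<nu> u v = frame u v e\<^sub>2"
        "\<nu> v u = frame u v (- e\<^sub>2)"
        using u True anti[of v u] by (simp_all add: frame_def)
      from basis[OF u(1) this(1,3,4,2)] frame_in_GL_V[OF u(1)] show ?thesis
        unfolding L\<^sub>3_def by blast
    qed
    consider "v = 0" | "v $ 2 \<noteq> 0" | "v $ 1 \<noteq> 0" "v $ 2 = 0"
      by (auto simp: vec_eq_iff forall_2)
    then show ?thesis
    proof cases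
      case 1
      then have "(?Z, \<nu>) = act id (?Z, bil_table (0 *s e\<^sub>2) 0 0 0)" by (simp add: \<nu> act_id)
      then show ?thesis using id_in_GL_V by blast
    next
      case 2
      \<comment> \<open>[\<open>e\<^sub>1\<close>, v] is \<open>v $ 2\<close> times v, which
        explains the scaling; if this coordinate is 0, [\<open>e\<^sub>2\<close>, v] = -
        \<open>v $ 1\<close> times v serves instead.\<close>
      then have "\<exists>g\<in>GL_V. (?Z, \<nu>) = act g L\<^sub>3"
        by (intro L3[of "(1 / v $ 2) *s e\<^sub>1"]) (simp_all add: wedge_def \<nu> bil_table_def)
      then show ?thesis by blast
    next
      case 3
      then have "\<exists>g\<in>GL_V. (?Z, \<nu>) = act g L\<^sub>3"
        by (intro L3[of "(- 1 / v $ 1) *s e\<^sub>2"])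
           (simp_all add: wedge_def \<nu> bil_table_def vec_eq_iff)
      then show ?thesis by blast
    qed
  next
    case False
    then obtain y where "\<nu> y y \<noteq> 0" by blast
    define w where "w = \<nu> y y"
    have w: "w \<noteq> 0" "\<nu> y y = w" using \<open>\<nu> y y \<noteq> 0\<close> by (simp_all add: w_def)
    have xw: "\<nu> x w = 0" for x using D(5)[of x y y] by (simp add: w_def)
    have "y \<noteq> 0" using w add(3)[of 0 0 y] by auto
    have yw: "wedge y w \<noteq> 0"
    proof
      assume "wedge y w = 0"
      then obtain c where c: "w = c *s y" using \<open>y \<noteq> 0\<close> by (rule parallel_vec2)
      then have "c *s w = 0" using xw[of y] by (simp add: add w(2))
      then show False using c w(1) by auto
    qed
    define c d where "c = coframe y w (\<nu> w y) $ 1" and "d = coframe y w (\<nu> w y) $ 2"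
    have wy: "\<nu> w y = c *s y + d *s w"
      using frame_coframe[OF yw, of "\<nu> w y"] by (simp add: frame_def c_def d_def)
    have "c = 0"
    proof (rule ccontr)
      assume "c \<noteq> 0"
      \<comment> \<open>The Leibniz identity for w, w, y: two of its three terms have w as right
        argument and the first contains [w, w], so only [w, [w, y]] survives.\<close>
      have "0 = \<nu> w (\<nu> w y)" using D(5)[of w w y] xw add(3)[of 0 0 y] by simp
      also have "\<dots> = c *s \<nu> w y" by (subst wy) (simp add: add xw)
      finally have "\<nu> w y = 0" using \<open>c \<noteq> 0\<close> by simp
      with wy have "c *s y + d *s w = 0" by simp
      then have "wedge (c *s y + d *s w) w = 0" by (simp add: wedge_def)
      then show False using \<open>c \<noteq> 0\<close> yw by (simp add: wedge_linear)
    qed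
    then have wy: "\<nu> w y = d *s w" using wy by simp
    show ?thesis
    proof (cases "d = 0")
      case True
      have "\<nu> y y = frame y w (1 *s e\<^sub>2)" "\<nu> y w = frame y w 0" "\<nu> w y = frame y w 0"
        "\<nu> w w = frame y w 0"
        using wy xw w True by (simp_all add: frame_def)
      from basis[OF yw this] frame_in_GL_V[OF yw] show ?thesis by blast
    next
      case False
      \<comment> \<open>The shift cancels the square: [z, z] = w - [w, y] / d = 0.\<close>
      define z where "z = y - (1 / d) *s w"
      have zw: "wedge z w \<noteq> 0" using yw by (simp add: z_def wedge_linear)
      have "\<nu> z z = frame z w 0" "\<nu> z w = frame z w 0" "\<nu> w z = frame z w (d *s e\<^sub>2)"
        "\<nu> w w = frame z w 0"
        using wy xw w False by (simp_all add: frame_def z_def add)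
      from basis[OF zw this] frame_in_GL_V[OF zw] show ?thesis by blast
    qed
  qed
qed

subsection \<open>Covering by the four closures\<close>

text \<open>\<open>C\<close> stands for the closure of the family; the two shapes are those that the
  normal forms leave outside the listed orbits.\<close>

lemma in_L6_orbits:
  assumes "closedin zariski C" and C: "\<And>\<alpha>. orbit (L\<^sub>6 \<alpha>) \<subseteq> C" and g: "g \<in> GL_V"
  shows "act g (bil_table 0 0 0 0, bil_table 0 0 (\<delta> *s e\<^sub>2) 0) \<in> C"
    and "act g (bil_table (\<sigma> *s e\<^sub>2) 0 0 0, bil_table (\<beta> *s e\<^sub>2) 0 0 0) \<in> C"
proof -
  have in_C: "act g T \<in> C" if "wedge u w \<noteq> 0" "T = act (frame u w) (L\<^sub>6 \<alpha>)" for T u w \<alpha>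
    using C that frame_in_GL_V act_in_orbit[OF g] unfolding orbit_def by blast
  note defs = frame_def vec_eq_iff forall_2 bil_table_def
  show "act g (bil_table 0 0 0 0, bil_table 0 0 (\<delta> *s e\<^sub>2) 0) \<in> C"
  proof (rule closed_degeneration[OF assms(1) g])
    fix t :: complex assume t: "t \<noteq> 0"
    \<comment> \<open>The idempotent of the product with \<open>e\<^sub>1\<close> squared equal to t
      times \<open>e\<^sub>1\<close>. The parameter \<delta> / t compensates the scaling, so the
      bracket stays constant while the product tends to 0.\<close>
    let ?u = "(1 / t) *s e\<^sub>1"
    have "wedge ?u e\<^sub>2 \<noteq> 0" using t by (simp add: wedge_def)
    moreover have "(bil_table (t *s e\<^sub>1) 0 0 0, bil_table 0 0 (\<delta> *s e\<^sub>2) 0)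
        = act (frame ?u e\<^sub>2) (L\<^sub>6 (\<delta> / t))"
      unfolding L\<^sub>6_def using t
      by (intro pair_in_basis bil_table_in_Bil) (simp_all add: defs wedge_def)
    ultimately show "act g (bil_table (t *s e\<^sub>1) 0 0 0, bil_table 0 0 (\<delta> *s e\<^sub>2) 0) \<in> C"
      by (rule in_C)
  qed (simp_all add: bil_table_in_Bil, auto simp: bil_table_def intro!: tendsto_eq_intros)
  have nonzero: "act g (bil_table (s *s e\<^sub>2) 0 0 0, bil_table (\<beta> *s e\<^sub>2) 0 0 0) \<in> C"
    if s: "s \<noteq> 0" for s
  proof (rule closed_degeneration[OF assms(1) g])
    fix t :: complex assume t: "t \<noteq> 0"
    \<comment> \<open>The product is deformed to x y = (l(x) l(y) / s) \<open>e\<^sub>2\<close> with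
      l(x) = s \<open>x $ 1\<close> + t \<open>x $ 2\<close>. Since l(\<open>e\<^sub>2\<close>) = t
      is nonzero, \<open>?u\<close> is its idempotent, and \<open>?w\<close> spans the kernel of l.
      In this basis [\<open>e\<^sub>1\<close>, \<open>e\<^sub>1\<close>] has second coordinate -
      \<alpha> s, whence the choice of \<open>?\<alpha>\<close>.\<close>
    let ?u = "(s / t\<^sup>2) *s e\<^sub>2" and ?w = "e\<^sub>1 - (s / t) *s e\<^sub>2" and ?\<alpha> = "- \<beta> / s"
    let ?T = "(bil_table (s *s e\<^sub>2) (t *s e\<^sub>2) (t *s e\<^sub>2) ((t\<^sup>2 / s) *s e\<^sub>2),
        bil_table (\<beta> *s e\<^sub>2 + (?\<alpha> * t) *s e\<^sub>1)
          ((?\<alpha> * t\<^sup>2 / s) *s e\<^sub>1 - (?\<alpha> * t) *s e\<^sub>2) 0 0)"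
    have "wedge ?u ?w \<noteq> 0" using t s by (simp add: wedge_def)
    moreover have "?T = act (frame ?u ?w) (L\<^sub>6 ?\<alpha>)"
      unfolding L\<^sub>6_def using t s
      by (intro pair_in_basis bil_table_in_Bil)
         (simp_all add: defs wedge_def field_simps power2_eq_square)
    ultimately show "act g ?T \<in> C" by (rule in_C)
  qed (simp_all add: bil_table_in_Bil, auto simp: s bil_table_def intro!: tendsto_eq_intros)
  show "act g (bil_table (\<sigma> *s e\<^sub>2) 0 0 0, bil_table (\<beta> *s e\<^sub>2) 0 0 0) \<in> C"
  \<comment> \<open>The deformation divides by s, so \<sigma> = 0 is reached by a second limit s ->
    0.\<close>
  proof (cases "\<sigma> = 0")
    case True
    show ?thesis
    proof (rule closed_degeneration[OF assms(1) g])
      show "act g (bil_table (t *s e\<^sub>2) 0 0 0, bil_table (\<beta> *s e\<^sub>2) 0 0 0) \<in> C" if "t \<noteq> 0" for t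
        using that by (rule nonzero)
    qed (simp_all add: bil_table_in_Bil, auto simp: bil_table_def True intro!: tendsto_eq_intros)
  qed (rule nonzero)
qed

lemma LP_variety_cover:
  assumes "T \<in> LP_variety"
  shows "T \<in> orbit L\<^sub>3 \<or> T \<in> orbit L\<^sub>4 \<or> (\<exists>\<alpha>. T \<in> orbit (L\<^sub>5 \<alpha>))
    \<or> T \<in> zariski closure_of (\<Union>\<alpha>. orbit (L\<^sub>6 \<alpha>))"
proof -
  let ?C = "zariski closure_of (\<Union>\<alpha>. orbit (L\<^sub>6 \<alpha>))"
  have "(\<Union>\<alpha>. orbit (L\<^sub>6 \<alpha>)) \<subseteq> topspace zariski"
    unfolding orbit_def topspace_zariski L\<^sub>6_def using act_in_Bil bil_table_in_Bil by blast
  then have L6: "orbit (L\<^sub>6 \<alpha>) \<subseteq> ?C" for \<alpha>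
    using closure_of_subset by blast
  note limits = in_L6_orbits[OF closedin_closure_of L6]
  obtain \<mu> \<nu> where T: "T = (\<mu>, \<nu>)" by (cases T)
  note LP = assms[unfolded T]
  show ?thesis
  proof (cases "\<exists>v. wedge v (\<mu> v v) \<noteq> 0")
    case True
    then obtain g M \<nu>' where g: "g \<in> GL_V" "T = act g (M, \<nu>')" "(M, \<nu>') \<in> LP_variety"
      and M: "M \<in> {bil_table e\<^sub>1 0 0 e\<^sub>2, bil_table e\<^sub>1 e\<^sub>2 e\<^sub>2 0, bil_table e\<^sub>1 0 0 0, bil_table e\<^sub>2 0 0 0}"
      using cyclic_product[OF LP] unfolding T by blast
    have orbit: "T \<in> orbit S" if "(M, \<nu>') = S" for S
      using g(1,2) that unfolding orbit_def by blast
    from M consider "M = bil_table e\<^sub>1 0 0 e\<^sub>2" | "M = bil_table e\<^sub>1 e\<^sub>2 e\<^sub>2 0" | "M = bil_table e\<^sub>1 0 0 0"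
      | "M = bil_table e\<^sub>2 0 0 0" by blast
    then show ?thesis
    proof cases
      case 1
      with bracket_of_table(1)[OF g(3)] orbit show ?thesis by blast
    next
      case 2
      with bracket_of_table(2)[OF g(3)] orbit show ?thesis by blast
    next
      case 3
      with bracket_of_table(3)[OF g(3)] orbit L6 show ?thesis by blast
    next
      case 4
      with bracket_of_table(4)[OF g(3)] obtain \<beta> where "\<nu>' = bil_table (\<beta> *s e\<^sub>2) 0 0 0" by blast
      with limits(2)[OF g(1), of 1 \<beta>] 4 show ?thesis by (simp add: g(2))
    qed
  next
    case False
    then have \<mu>: "\<mu> = bil_table 0 0 0 0" using noncyclic_product[OF LP] by blast
    from leibniz_normal_form[OF LP[unfolded \<mu>]] obtain g where g: "g \<in> GL_V"
      and "T = act g L\<^sub>3 \<or> (\<exists>\<beta>. T = act g (bil_table 0 0 0 0, bil_table (\<beta> *s e\<^sub>2) 0 0 0))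
        \<or> (\<exists>\<delta>. T = act g (bil_table 0 0 0 0, bil_table 0 0 (\<delta> *s e\<^sub>2) 0))"
      unfolding T \<mu> by blast
    moreover have "act g (bil_table 0 0 0 0, bil_table (\<beta> *s e\<^sub>2) 0 0 0) \<in> ?C" for \<beta>
      using limits(2)[OF g, of 0 \<beta>] by simp
    moreover have "act g L\<^sub>3 \<in> orbit L\<^sub>3" using g unfolding orbit_def by blast
    ultimately show ?thesis using limits(1)[OF g] by metis
  qed
qed

subsection \<open>Separating the components\<close>

lemma act_apply:
  "fst (act g T) x y = g (fst T (inv g x) (inv g y))"
  "snd (act g T) x y = g (snd T (inv g x) (inv g y))"
  by (simp_all add: act_def case_prod_unfold)

lemma GL_V_zero: "g \<in> GL_V \<Longrightarrow> g 0 = 0"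
  using GL_V_add[of g 0 0] by simp

lemma closure_orbits_subset:
  assumes "closedin zariski Z" "\<And>\<alpha>. L \<alpha> \<in> Z" "\<And>g T. g \<in> GL_V \<Longrightarrow> T \<in> Z \<Longrightarrow> act g T \<in> Z"
  shows "zariski closure_of (\<Union>\<alpha>. orbit (L \<alpha>)) \<subseteq> Z"
  unfolding orbit_def by (intro closure_of_minimal UN_least subsetI assms(1)) (use assms(2,3) in blast)

lemma closure_orbit_subset:
  assumes "closedin zariski Z" "T \<in> Z" "\<And>g T. g \<in> GL_V \<Longrightarrow> T \<in> Z \<Longrightarrow> act g T \<in> Z"
  shows "zariski closure_of orbit T \<subseteq> Z"
  using closure_orbits_subset[of Z "\<lambda>_. T"] assms by simp

text \<open>Holds for the last three families, where brackets are multiples of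
  \<open>e\<^sub>2\<close> and vanish when the right argument is one; in \<open>L\<^sub>3\<close>,
  bracketing with \<open>e\<^sub>1\<close> on the left fixes \<open>e\<^sub>2\<close>.\<close>

definition iterated_bracket_zero :: "(bil \<times> bil) set" where
  "iterated_bracket_zero = {T \<in> Bil \<times> Bil. \<forall>x y z. snd T x (snd T y z) = 0}"

definition product_zero :: "(bil \<times> bil) set" where
  "product_zero = {T \<in> Bil \<times> Bil. \<forall>x y. fst T x y = 0}"

definition bracket_zero :: "(bil \<times> bil) set" where
  "bracket_zero = {T \<in> Bil \<times> Bil. \<forall>x y. snd T x y = 0}"

text \<open>The products span at most a line, as in \<open>L\<^sub>6\<close>, whereas they span the
  plane in \<open>L\<^sub>4\<close> and \<open>L\<^sub>5\<close>.\<close>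

definition products_parallel :: "(bil \<times> bil) set" where
  "products_parallel = {T \<in> Bil \<times> Bil. \<forall>x y z w. wedge (fst T x y) (fst T z w) = 0}"

text \<open>In the next set the characteristic polynomial of the multiplication by any \<open>x\<close> has
  discriminant zero: its trace and determinant are the factors by which \<open>a \<and> b\<close> is multiplied
  in \<open>xa \<and> b + a \<and> xb\<close> and \<open>xa \<and> xb\<close>.\<close>

definition discriminant_zero :: "(bil \<times> bil) set" where
  "discriminant_zero = {T \<in> Bil \<times> Bil. \<forall>x a b.
     (wedge (fst T x a) b + wedge a (fst T x b)) * (wedge (fst T x a) b + wedge a (fst T x b))
     - 4 * (wedge a b * wedge (fst T x a) (fst T x b)) = 0}"

lemma closedin_separating:
  "closedin zariski iterated_bracket_zero" "closedin zariski product_zero"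
  "closedin zariski bracket_zero" "closedin zariski products_parallel"
  "closedin zariski discriminant_zero"
proof -
  show "closedin zariski iterated_bracket_zero"
    unfolding iterated_bracket_zero_def
    by (intro closedin_zariski_identity regular_snd regular_const)
  show "closedin zariski product_zero"
    using closedin_zariski_identity[of "\<lambda>x y z T. fst T x y", OF regular_fst[OF regular_const regular_const]]
    unfolding product_zero_def by simp
  show "closedin zariski bracket_zero"
    using closedin_zariski_identity[of "\<lambda>x y z T. snd T x y", OF regular_snd[OF regular_const regular_const]]
    unfolding bracket_zero_def by simp
  have "closedin zariski {T \<in> Bil \<times> Bil. \<forall>i::vec2 \<times> vec2 \<times> vec2 \<times> vec2.
      wedge (fst T (fst i) (fst (snd i))) (fst T (fst (snd (snd i))) (snd (snd (snd i)))) = 0}"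
    by (intro closedin_zariski_zeros regular_wedge regular_fst regular_const)
  then show "closedin zariski products_parallel"
    unfolding products_parallel_def by (simp only: split_paired_All fst_conv snd_conv)
  let ?t = "\<lambda>x a b T. wedge (fst T x a) b + wedge a (fst T x b)"
  have "closedin zariski {T \<in> Bil \<times> Bil. \<forall>i::vec2 \<times> vec2 \<times> vec2.
      ?t (fst i) (fst (snd i)) (snd (snd i)) T * ?t (fst i) (fst (snd i)) (snd (snd i)) T
      - 4 * (wedge (fst (snd i)) (snd (snd i)) *
          wedge (fst T (fst i) (fst (snd i))) (fst T (fst i) (snd (snd i)))) = 0}"
    by (intro closedin_zariski_zeros regular_diff regular_mult regular_add regular_wedge
        regular_fst regular_const)
  then show "closedin zariski discriminant_zero"
    unfolding discriminant_zero_def by (simp only: split_paired_All fst_conv snd_conv)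
qed

lemma act_in_separating:
  assumes g: "g \<in> GL_V"
  shows "T \<in> iterated_bracket_zero \<Longrightarrow> act g T \<in> iterated_bracket_zero"
    "T \<in> product_zero \<Longrightarrow> act g T \<in> product_zero"
    "T \<in> bracket_zero \<Longrightarrow> act g T \<in> bracket_zero"
    "T \<in> products_parallel \<Longrightarrow> act g T \<in> products_parallel"
    "T \<in> discriminant_zero \<Longrightarrow> act g T \<in> discriminant_zero"
proof -
  obtain D where D: "\<And>x y. wedge (g x) (g y) = D * wedge x y" using g by (rule wedge_GL_V) blast
  note simps = act_apply GL_V_inv_apply[OF g] GL_V_zero[OF g] D
  show "T \<in> iterated_bracket_zero \<Longrightarrow> act g T \<in> iterated_bracket_zero"
    "T \<in> product_zero \<Longrightarrow> act g T \<in> product_zero"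
    "T \<in> bracket_zero \<Longrightarrow> act g T \<in> bracket_zero"
    "T \<in> products_parallel \<Longrightarrow> act g T \<in> products_parallel"
    using act_in_Bil[OF g, of T]
    unfolding iterated_bracket_zero_def product_zero_def bracket_zero_def products_parallel_def
    by (simp_all add: simps)
  assume T: "T \<in> discriminant_zero"
  show "act g T \<in> discriminant_zero"
    unfolding discriminant_zero_def
  proof (intro CollectI conjI allI)
    show "act g T \<in> Bil \<times> Bil" using act_in_Bil[OF g] T by (simp add: discriminant_zero_def)
    fix x a b
    define x' a' b' where "x' = inv g x" and a': "a' = inv g a" and b': "b' = inv g b"
    let ?t = "wedge (fst T x' a') b' + wedge a' (fst T x' b')"
    have ab: "a = g a'" "b = g b'" by (simp_all add: a' b' GL_V_apply_inv[OF g])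
    have fst: "fst (act g T) x a = g (fst T x' a')" "fst (act g T) x b = g (fst T x' b')"
      by (simp_all add: act_apply x'_def a' b')
    have "?t * ?t - 4 * (wedge a' b' * wedge (fst T x' a') (fst T x' b')) = 0"
      using T unfolding discriminant_zero_def by blast
    \<comment> \<open>Every term is a product of two wedges, so \<open>g\<close> multiplies the
      discriminant by the square of \<open>D\<close>.\<close>
    then have "D * D * (?t * ?t - 4 * (wedge a' b' * wedge (fst T x' a') (fst T x' b'))) = 0"
      by simp
    then show "(wedge (fst (act g T) x a) b + wedge a (fst (act g T) x b))
        * (wedge (fst (act g T) x a) b + wedge a (fst (act g T) x b))
        - 4 * (wedge a b * wedge (fst (act g T) x a) (fst (act g T) x b)) = 0"
      unfolding fst unfolding ab D by (simp only: algebra_simps)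
  qed
qed

text \<open>For the discriminant: in \<open>L\<^sub>5\<close>, multiplication by x is triangular
  with \<open>x $ 1\<close> twice on the diagonal.\<close>

lemma L_memberships:
  "L\<^sub>4 \<in> iterated_bracket_zero" "L\<^sub>5 \<alpha> \<in> iterated_bracket_zero" "L\<^sub>6 \<alpha> \<in> iterated_bracket_zero"
  "L\<^sub>3 \<in> product_zero" "L\<^sub>4 \<in> bracket_zero" "L\<^sub>5 \<alpha> \<in> discriminant_zero"
  "L\<^sub>6 \<alpha> \<in> products_parallel"
  unfolding iterated_bracket_zero_def product_zero_def bracket_zero_def discriminant_zero_def
    products_parallel_def L\<^sub>3_def L\<^sub>4_def L\<^sub>5_def L\<^sub>6_def
  by (simp_all add: bil_table_in_Bil)
     (simp_all add: bil_table_def wedge_def vec_eq_iff algebra_simps)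

lemma L_nonmemberships:
  "L\<^sub>3 \<notin> iterated_bracket_zero" "L\<^sub>4 \<notin> product_zero" "L\<^sub>5 \<alpha> \<notin> product_zero" "L\<^sub>6 \<alpha> \<notin> product_zero"
  "L\<^sub>5 1 \<notin> bracket_zero" "L\<^sub>6 1 \<notin> bracket_zero" "L\<^sub>4 \<notin> discriminant_zero" "L\<^sub>6 \<alpha> \<notin> discriminant_zero"
  "L\<^sub>4 \<notin> products_parallel" "L\<^sub>5 \<alpha> \<notin> products_parallel"
proof -
  have e: "e\<^sub>1 \<noteq> 0" "e\<^sub>2 \<noteq> 0" by (simp_all add: vec_eq_iff forall_2)
  have "snd L\<^sub>3 e\<^sub>1 (snd L\<^sub>3 e\<^sub>1 e\<^sub>2) \<noteq> 0" using e by (simp add: L\<^sub>3_def)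
  then show "L\<^sub>3 \<notin> iterated_bracket_zero" unfolding iterated_bracket_zero_def by blast
  have "fst L\<^sub>4 e\<^sub>1 e\<^sub>1 \<noteq> 0" "fst (L\<^sub>5 \<alpha>) e\<^sub>1 e\<^sub>1 \<noteq> 0" "fst (L\<^sub>6 \<alpha>) e\<^sub>1 e\<^sub>1 \<noteq> 0"
    using e by (simp_all add: L\<^sub>4_def L\<^sub>5_def L\<^sub>6_def)
  then show "L\<^sub>4 \<notin> product_zero" "L\<^sub>5 \<alpha> \<notin> product_zero" "L\<^sub>6 \<alpha> \<notin> product_zero"
    unfolding product_zero_def by blast+
  \<comment> \<open>At \<alpha> = 0 the bracket vanishes, so a member with nonzero parameter has to
    be the witness.\<close>
  have "snd (L\<^sub>5 1) e\<^sub>2 e\<^sub>1 \<noteq> 0" "snd (L\<^sub>6 1) e\<^sub>2 e\<^sub>1 \<noteq> 0"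
    using e by (simp_all add: L\<^sub>5_def L\<^sub>6_def)
  then show "L\<^sub>5 1 \<notin> bracket_zero" "L\<^sub>6 1 \<notin> bracket_zero"
    unfolding bracket_zero_def by blast+
  \<comment> \<open>In both algebras multiplication by \<open>e\<^sub>1\<close> has the distinct
    eigenvalues 1 and 0.\<close>
  have "(wedge (fst T e\<^sub>1 e\<^sub>1) e\<^sub>2 + wedge e\<^sub>1 (fst T e\<^sub>1 e\<^sub>2)) * (wedge (fst T e\<^sub>1 e\<^sub>1) e\<^sub>2 + wedge e\<^sub>1 (fst T e\<^sub>1 e\<^sub>2))
     - 4 * (wedge e\<^sub>1 e\<^sub>2 * wedge (fst T e\<^sub>1 e\<^sub>1) (fst T e\<^sub>1 e\<^sub>2)) \<noteq> 0" if "T = L\<^sub>4 \<or> T = L\<^sub>6 \<alpha>" for T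
    using that by (auto simp: L\<^sub>4_def L\<^sub>6_def wedge_def)
  then show "L\<^sub>4 \<notin> discriminant_zero" "L\<^sub>6 \<alpha> \<notin> discriminant_zero"
    unfolding discriminant_zero_def by blast+
  have "wedge (fst L\<^sub>4 e\<^sub>1 e\<^sub>1) (fst L\<^sub>4 e\<^sub>2 e\<^sub>2) \<noteq> 0" "wedge (fst (L\<^sub>5 \<alpha>) e\<^sub>1 e\<^sub>1) (fst (L\<^sub>5 \<alpha>) e\<^sub>1 e\<^sub>2) \<noteq> 0"
    by (simp_all add: L\<^sub>4_def L\<^sub>5_def wedge_def)
  then show "L\<^sub>4 \<notin> products_parallel" "L\<^sub>5 \<alpha> \<notin> products_parallel"
    unfolding products_parallel_def by blast+
qed

lemma irreducible_in_L_orbits: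
  "irreducible_in zariski (orbit L\<^sub>3)" "irreducible_in zariski (orbit L\<^sub>4)"
  "irreducible_in zariski (\<Union>\<alpha>. orbit (L\<^sub>5 \<alpha>))" "irreducible_in zariski (\<Union>\<alpha>. orbit (L\<^sub>6 \<alpha>))"
proof -
  note irr = irreducible_in_orbits[OF bil_table_in_Bil bil_table_in_Bil bil_table_in_Bil]
  \<comment> \<open>\<open>L\<^sub>3\<close> and \<open>L\<^sub>4\<close> are written as families
    constant in \<alpha>, so that the union over \<alpha> collapses to one orbit.\<close>
  have eq: "L\<^sub>3 = (bil_table 0 0 0 0, \<lambda>x y. bil_table 0 e\<^sub>2 (- e\<^sub>2) 0 x y + \<alpha> *s bil_table 0 0 0 0 x y)"
    "L\<^sub>4 = (bil_table e\<^sub>1 0 0 e\<^sub>2, \<lambda>x y. bil_table 0 0 0 0 x y + \<alpha> *s bil_table 0 0 0 0 x y)"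
    "L\<^sub>5 \<alpha> = (bil_table e\<^sub>1 e\<^sub>2 e\<^sub>2 0, \<lambda>x y. bil_table 0 0 0 0 x y + \<alpha> *s bil_table 0 0 e\<^sub>2 0 x y)"
    "L\<^sub>6 \<alpha> = (bil_table e\<^sub>1 0 0 0, \<lambda>x y. bil_table 0 0 0 0 x y + \<alpha> *s bil_table 0 0 e\<^sub>2 0 x y)" for \<alpha>
    by (simp_all add: L\<^sub>3_def L\<^sub>4_def L\<^sub>5_def L\<^sub>6_def bil_table_def fun_eq_iff vec_eq_iff)
  show "irreducible_in zariski (orbit L\<^sub>3)"
    using irr[of 0 0 0 0 0 e\<^sub>2 "- e\<^sub>2" 0 0 0 0 0, folded eq(1)] by simp
  show "irreducible_in zariski (orbit L\<^sub>4)"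
    using irr[of e\<^sub>1 0 0 e\<^sub>2 0 0 0 0 0 0 0 0, folded eq(2)] by simp
  show "irreducible_in zariski (\<Union>\<alpha>. orbit (L\<^sub>5 \<alpha>))" "irreducible_in zariski (\<Union>\<alpha>. orbit (L\<^sub>6 \<alpha>))"
    unfolding eq by (rule irr)+
qed

lemma L_in_LP_variety: "L\<^sub>3 \<in> LP_variety" "L\<^sub>4 \<in> LP_variety" "L\<^sub>5 \<alpha> \<in> LP_variety" "L\<^sub>6 \<alpha> \<in> LP_variety"
  unfolding L\<^sub>3_def L\<^sub>4_def L\<^sub>5_def L\<^sub>6_def LP_variety_iff
  by (simp_all add: bil_table_in_Bil)
     (simp_all add: bil_table_def vec_eq_iff forall_2 algebra_simps)

theorem theorem21:
  "irreducible_components (subtopology zariski LP_variety) =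
     {zariski closure_of orbit L\<^sub>3,
      zariski closure_of orbit L\<^sub>4,
      zariski closure_of (\<Union>\<alpha>. orbit (L\<^sub>5 \<alpha>)),
      zariski closure_of (\<Union>\<alpha>. orbit (L\<^sub>6 \<alpha>))}
   \<and> card (irreducible_components (subtopology zariski LP_variety)) = 4"
proof -
  define C3 where "C3 = zariski closure_of orbit L\<^sub>3"
  define C4 where "C4 = zariski closure_of orbit L\<^sub>4"
  define C5 where "C5 = zariski closure_of (\<Union>\<alpha>. orbit (L\<^sub>5 \<alpha>))"
  define C6 where "C6 = zariski closure_of (\<Union>\<alpha>. orbit (L\<^sub>6 \<alpha>))"
  note C = C3_def C4_def C5_def C6_def
  note irr = irreducible_in_L_orbits[THEN irreducible_in_closure_of, folded C]
  have sub: "orbit L\<^sub>3 \<subseteq> C3" "orbit L\<^sub>4 \<subseteq> C4" "(\<Union>\<alpha>. orbit (L\<^sub>5 \<alpha>)) \<subseteq> C5" "(\<Union>\<alpha>. orbit (L\<^sub>6 \<alpha>)) \<subseteq> C6"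
    using irreducible_in_L_orbits unfolding C irreducible_in_def by (simp_all add: closure_of_subset)
  have mem: "L\<^sub>3 \<in> C3" "L\<^sub>4 \<in> C4" "L\<^sub>5 \<alpha> \<in> C5" "L\<^sub>6 \<alpha> \<in> C6" for \<alpha>
    using sub self_in_orbit by blast+
  note LP_orbit = closure_orbit_subset[OF closedin_LP_variety _ act_in_LP_variety]
    and LP_orbits = closure_orbits_subset[OF closedin_LP_variety _ act_in_LP_variety]
  have LP: "C3 \<subseteq> LP_variety" "C4 \<subseteq> LP_variety" "C5 \<subseteq> LP_variety" "C6 \<subseteq> LP_variety"
    unfolding C using LP_orbit[OF L_in_LP_variety(1)] LP_orbit[OF L_in_LP_variety(2)]
      LP_orbits[OF L_in_LP_variety(3)] LP_orbits[OF L_in_LP_variety(4)]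
    by simp_all
  have inc: "C4 \<subseteq> iterated_bracket_zero" "C5 \<subseteq> iterated_bracket_zero" "C6 \<subseteq> iterated_bracket_zero"
    "C3 \<subseteq> product_zero" "C4 \<subseteq> bracket_zero" "C5 \<subseteq> discriminant_zero" "C6 \<subseteq> products_parallel"
    unfolding C
    using closure_orbit_subset[OF closedin_separating(1) L_memberships(1) act_in_separating(1)]
      closure_orbits_subset[OF closedin_separating(1) L_memberships(2) act_in_separating(1)]
      closure_orbits_subset[OF closedin_separating(1) L_memberships(3) act_in_separating(1)]
      closure_orbit_subset[OF closedin_separating(2) L_memberships(4) act_in_separating(2)]
      closure_orbit_subset[OF closedin_separating(3) L_memberships(5) act_in_separating(3)]
      closure_orbits_subset[OF closedin_separating(5) L_memberships(6) act_in_separating(5)]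
      closure_orbits_subset[OF closedin_separating(4) L_memberships(7) act_in_separating(4)]
    by simp_all
  have sep: "\<not> A \<subseteq> B" if "T \<in> A" "B \<subseteq> Z" "T \<notin> Z" for A B Z :: "(bil \<times> bil) set" and T
    using that by (meson subsetD)
  \<comment> \<open>The iterated bracket keeps C3 out of the others and the zero product keeps them
    out of C3. Zero bracket, zero discriminant and parallel products bound C4, C5 and C6 against
    each other.\<close>
  have not: "\<not> C3 \<subseteq> C4" "\<not> C3 \<subseteq> C5" "\<not> C3 \<subseteq> C6" "\<not> C4 \<subseteq> C3" "\<not> C5 \<subseteq> C3" "\<not> C6 \<subseteq> C3"
    "\<not> C5 \<subseteq> C4" "\<not> C6 \<subseteq> C4" "\<not> C4 \<subseteq> C5" "\<not> C6 \<subseteq> C5" "\<not> C4 \<subseteq> C6" "\<not> C5 \<subseteq> C6"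
    using sep[OF mem(1) inc(1) L_nonmemberships(1)]
      sep[OF mem(1) inc(2) L_nonmemberships(1)]
      sep[OF mem(1) inc(3) L_nonmemberships(1)]
      sep[OF mem(2) inc(4) L_nonmemberships(2)]
      sep[OF mem(3) inc(4) L_nonmemberships(3)]
      sep[OF mem(4) inc(4) L_nonmemberships(4)]
      sep[OF mem(3) inc(5) L_nonmemberships(5)]
      sep[OF mem(4) inc(5) L_nonmemberships(6)]
      sep[OF mem(2) inc(6) L_nonmemberships(7)]
      sep[OF mem(4) inc(6) L_nonmemberships(8)]
      sep[OF mem(2) inc(7) L_nonmemberships(9)]
      sep[OF mem(3) inc(7) L_nonmemberships(10)]
    by simp_all
  have "irreducible_components (subtopology zariski LP_variety) = {C3, C4, C5, C6}"
  proof (rule irreducible_components_eq)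
    have "T \<in> C3 \<union> C4 \<union> C5 \<union> C6" if "T \<in> LP_variety" for T
      using LP_variety_cover[OF that] sub unfolding C6_def[symmetric] by blast
    moreover have "LP_variety \<subseteq> topspace zariski"
      by (rule closedin_subset[OF closedin_LP_variety])
    ultimately show "topspace (subtopology zariski LP_variety) = \<Union>{C3, C4, C5, C6}"
      using LP by (auto simp del: topspace_zariski)
    show "closedin (subtopology zariski LP_variety) D" if "D \<in> {C3, C4, C5, C6}" for D
      using that LP by (intro closedin_subset_topspace) (auto simp: C)
    show "irreducible_in (subtopology zariski LP_variety) D" if "D \<in> {C3, C4, C5, C6}" for D
      using that irr LP irreducible_in_subtopology by blast
    show "D = E" if "D \<in> {C3, C4, C5, C6}" "E \<in> {C3, C4, C5, C6}" "D \<subseteq> E" for D E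
      using that not by blast
  qed simp
  \<comment> \<open>Set notation permits repetitions, so the count of four needs the sets to be
    distinct.\<close>
  moreover have "C3 \<noteq> C4" "C3 \<noteq> C5" "C3 \<noteq> C6" "C4 \<noteq> C5" "C4 \<noteq> C6" "C5 \<noteq> C6"
    using not by (simp_all add: set_eq_subset)
  then have "card {C3, C4, C5, C6} = 4" by simp
  ultimately show ?thesis unfolding C by simp
qed

end
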